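(* Let $\mathcal G$ be an étale groupoid that has a cover $\mathcal F$ consisting of compact open bisections. Then $\mathcal A(\mathcal G)$ coincides with the $C^*$-algebra $C^*(\mathcal G)$ of $\mathcal G$ (both being completions of $\mathcal A_0(\mathcal G)$).
   Context: An étale groupoid $\mathcal G$ is a topological groupoid whose unit space $\mathcal G^{(0)}$ is locally compact Hausdorff and whose source and range maps $\mathbf d,\mathbf r:\mathcal G\to\mathcal G^{(0)}$ are local homeomorphisms; $\mathcal G$ need not be Hausdorff. A bisection is an open set $U\subseteq\mathcal G$ on which $\mathbf d$ and $\mathbf r$ are injective. For an open Hausdorff $V\subseteq\mathcal G$, $C_c(V)$ denotes the functions $f:\mathcal G\to\mathbb C$ vanishing off $V$ whose restriction to $V$ is continuous with compact support. $\mathcal A_0(\mathcal G)$ is the linear span of all $C_c(V)$, $V$ open Hausdorff; it is an algebra under $(f*g)(z)=\sum_{xy=z}f(x)g(y)$, and has the involution $f^*(x)=\overline{f(x^{-1})}$. A representation of $\mathcal A_0(\mathcal G)$ is an algebra homomorphism $\pi:\mathcal A_0(\mathcal G)\to B(H)$, $H$ a Hilbert space, with $\|\pi(f)\|\le\|f\|_\infty$ for every bisection $U$ and $f\in C_c(U)$, and $\pi(\overline f)=\pi(f)^*$ for $f\in C_c(\mathcal G^{(0)})$ (it is not assumed to be a $*$-homomorphism). $\mathcal A(\mathcal G)$ is the Hausdorff completion of $\mathcal A_0(\mathcal G)$ in the seminorm $\sup_\pi\|\pi(f)\|$ over all such representations. $C^*(\mathcal G)$ is the completion of $\mathcal A_0(\mathcal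 G)$ in the norm $\sup_\pi\|\pi(f)\|$ over all $*$-representations of $\mathcal A_0(\mathcal G)$ on Hilbert spaces. "Coincides" means that the two (semi)norms on $\mathcal A_0(\mathcal G)$ are equal. *)

theory Defs
  imports
    "HOL-Analysis.Analysis"
    "HOL-Algebra.Module"
    "HOL-Library.Function_Algebras"
begin

section \<open>Etale groupoids\<close>

definition local_homeomorphism_map :: "'a topology \<Rightarrow> 'b topology \<Rightarrow> ('a \<Rightarrow> 'b) \<Rightarrow> bool" where
  "local_homeomorphism_map X Y f \<longleftrightarrow>
     f \<in> topspace X \<rightarrow> topspace Y \<and>
     (\<forall>x\<in>topspace X. \<exists>U. openin X U \<and> x \<in> U \<and> openin Y (f ` U) \<and>
        homeomorphic_map (subtopology X U) (subtopology Y (f ` U)) f)"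

text \<open>
  The arrows of a groupoid are the points of the space \<open>gtop\<close>, and units are identified with the
  identity arrows.  The product \<open>gmult x y\<close> is meaningful when \<open>gdom x = gran y\<close>; the values of the
  operations elsewhere are irrelevant and are never consulted below.
\<close>

record 'g groupoid_data =
  gtop :: "'g topology"
  gdom :: "'g \<Rightarrow> 'g"
  gran :: "'g \<Rightarrow> 'g"
  gmult :: "'g \<Rightarrow> 'g \<Rightarrow> 'g"
  ginv :: "'g \<Rightarrow> 'g"

definition arrows :: "'g groupoid_data \<Rightarrow> 'g set" where
  "arrows G = topspace (gtop G)"

definition units :: "'g groupoid_data \<Rightarrow> 'g set" where
  "units G = gdom G ` arrows G"

definition composable :: "'g groupoid_data \<Rightarrow> ('g \<times> 'g) set" where
  "composable G = {(x, y) \<in> arrows G \<times> arrows G. gdom G x = gran G y}"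

locale topological_groupoid =
  fixes G :: "'g groupoid_data"
  assumes dom_closed: "x \<in> arrows G \<Longrightarrow> gdom G x \<in> arrows G"
    and ran_closed: "x \<in> arrows G \<Longrightarrow> gran G x \<in> arrows G"
    and inv_closed: "x \<in> arrows G \<Longrightarrow> ginv G x \<in> arrows G"
    and mult_closed: "(x, y) \<in> composable G \<Longrightarrow> gmult G x y \<in> arrows G"
    and dom_dom: "x \<in> arrows G \<Longrightarrow> gdom G (gdom G x) = gdom G x"
    and ran_dom: "x \<in> arrows G \<Longrightarrow> gran G (gdom G x) = gdom G x"
    and dom_ran: "x \<in> arrows G \<Longrightarrow> gdom G (gran G x) = gran G x"
    and ran_ran: "x \<in> arrows G \<Longrightarrow> gran G (gran G x) = gran G x"
    and dom_mult: "(x, y) \<in> composable G \<Longrightarrow> gdom G (gmult G x y) = gdom G y"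
    and ran_mult: "(x, y) \<in> composable G \<Longrightarrow> gran G (gmult G x y) = gran G x"
    and mult_assoc: "(x, y) \<in> composable G \<Longrightarrow> (y, z) \<in> composable G \<Longrightarrow>
          gmult G (gmult G x y) z = gmult G x (gmult G y z)"
    and mult_dom: "x \<in> arrows G \<Longrightarrow> gmult G x (gdom G x) = x"
    and ran_mult_left: "x \<in> arrows G \<Longrightarrow> gmult G (gran G x) x = x"
    and dom_inv: "x \<in> arrows G \<Longrightarrow> gdom G (ginv G x) = gran G x"
    and ran_inv: "x \<in> arrows G \<Longrightarrow> gran G (ginv G x) = gdom G x"
    and inv_mult: "x \<in> arrows G \<Longrightarrow> gmult G (ginv G x) x = gdom G x"
    and mult_inv: "x \<in> arrows G \<Longrightarrow> gmult G x (ginv G x) = gran G x"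
    and continuous_mult:
      "continuous_map (subtopology (prod_topology (gtop G) (gtop G)) (composable G)) (gtop G)
         (\<lambda>(x, y). gmult G x y)"
    and continuous_inv: "continuous_map (gtop G) (gtop G) (ginv G)"

locale etale_groupoid = topological_groupoid +
  assumes Hausdorff_units: "Hausdorff_space (subtopology (gtop G) (units G))"
    and locally_compact_units: "locally_compact_space (subtopology (gtop G) (units G))"
    and local_homeomorphism_dom:
      "local_homeomorphism_map (gtop G) (subtopology (gtop G) (units G)) (gdom G)"
    and local_homeomorphism_ran:
      "local_homeomorphism_map (gtop G) (subtopology (gtop G) (units G)) (gran G)"

definition bisection :: "'g groupoid_data \<Rightarrow> 'g set \<Rightarrow> bool" where
  "bisection G U \<longleftrightarrow> openin (gtop G) U \<and> inj_on (gdom G) U \<and> inj_on (gran G) U"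


section \<open>The convolution algebra\<close>

text \<open>
  Functions on the groupoid are functions on the whole type \<open>'g\<close> that vanish off \<open>arrows G\<close>.
\<close>

definition Cc :: "'g groupoid_data \<Rightarrow> 'g set \<Rightarrow> ('g \<Rightarrow> complex) set" where
  "Cc G V = {f. (\<forall>x. x \<notin> V \<longrightarrow> f x = 0) \<and>
     continuous_map (subtopology (gtop G) V) euclidean f \<and>
     compactin (subtopology (gtop G) V)
       ((subtopology (gtop G) V) closure_of {x \<in> V. f x \<noteq> 0})}"

definition fscale :: "complex \<Rightarrow> ('g \<Rightarrow> complex) \<Rightarrow> 'g \<Rightarrow> complex" where
  "fscale c f = (\<lambda>x. c * f x)"

global_interpretation cfun: vector_space fscale
  by unfold_locales (auto simp: fscale_def fun_eq_iff algebra_simps)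

definition A0 :: "'g groupoid_data \<Rightarrow> ('g \<Rightarrow> complex) set" where
  "A0 G = cfun.span
     (\<Union>V \<in> {V. openin (gtop G) V \<and> Hausdorff_space (subtopology (gtop G) V)}. Cc G V)"

text \<open>For elements of \<open>A0 G\<close> only finitely many terms of this sum are nonzero.\<close>

definition conv ::
  "'g groupoid_data \<Rightarrow> ('g \<Rightarrow> complex) \<Rightarrow> ('g \<Rightarrow> complex) \<Rightarrow> 'g \<Rightarrow> complex" where
  "conv G f g = (\<lambda>z. \<Sum>\<^sub>\<infinity>(x, y) \<in> {(x, y) \<in> composable G. gmult G x y = z}. f x * g y)"

definition star :: "'g groupoid_data \<Rightarrow> ('g \<Rightarrow> complex) \<Rightarrow> 'g \<Rightarrow> complex" where
  "star G f = (\<lambda>x. if x \<in> arrows G then cnj (f (ginv G x)) else 0)"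

text \<open>
  The supremum runs over the whole type, which for a function vanishing off \<open>arrows G\<close> gives the
  supremum over the arrows, and \<open>0\<close> for the empty groupoid.
\<close>

definition sup_norm :: "('g \<Rightarrow> complex) \<Rightarrow> real" where
  "sup_norm f = (SUP x. cmod (f x))"


section \<open>Complex Hilbert spaces\<close>

definition complex_ring :: "complex ring" where
  "complex_ring = \<lparr>carrier = UNIV, monoid.mult = (*), one = 1, zero = 0, add = (+)\<rparr>"

text \<open>
  Hilbert spaces have an explicit carrier, so that a single type accommodates many Hilbert spaces
  and one can take suprema over them.  The fields \<open>mult\<close> and \<open>one\<close> inherited from the ring record
  underlying modules play no role.  The inner product is linear in its first argument.
\<close>

record 'h hilbert = "(complex, 'h) module" +
  hinner :: "'h \<Rightarrow> 'h \<Rightarrow> complex"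

definition hnorm :: "'h hilbert \<Rightarrow> 'h \<Rightarrow> real" where
  "hnorm H x = sqrt (Re (hinner H x x))"

definition hdist :: "'h hilbert \<Rightarrow> 'h \<Rightarrow> 'h \<Rightarrow> real" where
  "hdist H x y = hnorm H (x \<ominus>\<^bsub>H\<^esub> y)"

locale hilbert_space = module complex_ring H for H :: "'h hilbert" +
  assumes inner_add_left: "x \<in> carrier H \<Longrightarrow> y \<in> carrier H \<Longrightarrow> z \<in> carrier H \<Longrightarrow>
        hinner H (x \<oplus>\<^bsub>H\<^esub> y) z = hinner H x z + hinner H y z"
    and inner_scale_left: "x \<in> carrier H \<Longrightarrow> y \<in> carrier H \<Longrightarrow>
        hinner H (c \<odot>\<^bsub>H\<^esub> x) y = c * hinner H x y"
    and inner_commute: "x \<in> carrier H \<Longrightarrow> y \<in> carrier H \<Longrightarrow>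
        hinner H x y = cnj (hinner H y x)"
    and inner_pos: "x \<in> carrier H \<Longrightarrow> x \<noteq> \<zero>\<^bsub>H\<^esub> \<Longrightarrow> Re (hinner H x x) > 0"
    and complete: "(\<And>n. X n \<in> carrier H) \<Longrightarrow>
        (\<And>e. e > 0 \<Longrightarrow> \<exists>N::nat. \<forall>m\<ge>N. \<forall>n\<ge>N. hdist H (X m) (X n) < e) \<Longrightarrow>
        \<exists>l\<in>carrier H. (\<lambda>n. hdist H (X n) l) \<longlonglongrightarrow> 0"

text \<open>
  Operators are represented by functions on the whole type \<open>'h\<close>; only their values on the carrier
  matter, and equality of operators means equality on the carrier.
\<close>

definition bounded_operators :: "'h hilbert \<Rightarrow> ('h \<Rightarrow> 'h) set" where
  "bounded_operators H = {T. T \<in> carrier H \<rightarrow> carrier H \<and>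
     (\<forall>x\<in>carrier H. \<forall>y\<in>carrier H. T (x \<oplus>\<^bsub>H\<^esub> y) = T x \<oplus>\<^bsub>H\<^esub> T y) \<and>
     (\<forall>c. \<forall>x\<in>carrier H. T (c \<odot>\<^bsub>H\<^esub> x) = c \<odot>\<^bsub>H\<^esub> T x) \<and>
     (\<exists>C. \<forall>x\<in>carrier H. hnorm H (T x) \<le> C * hnorm H x)}"

definition opnorm :: "'h hilbert \<Rightarrow> ('h \<Rightarrow> 'h) \<Rightarrow> real" where
  "opnorm H T = (SUP x \<in> {x \<in> carrier H. hnorm H x \<le> 1}. hnorm H (T x))"

text \<open>\<open>is_adjoint H T S\<close> means \<open>S = T\<^sup>*\<close>; adjoints of bounded operators are unique.\<close>

definition is_adjoint :: "'h hilbert \<Rightarrow> ('h \<Rightarrow> 'h) \<Rightarrow> ('h \<Rightarrow> 'h) \<Rightarrow> bool" where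
  "is_adjoint H T S \<longleftrightarrow>
     (\<forall>x\<in>carrier H. \<forall>y\<in>carrier H. hinner H (T x) y = hinner H x (S y))"


section \<open>Representations and the two seminorms\<close>

definition algebra_hom ::
  "'g groupoid_data \<Rightarrow> 'h hilbert \<Rightarrow> (('g \<Rightarrow> complex) \<Rightarrow> 'h \<Rightarrow> 'h) \<Rightarrow> bool" where
  "algebra_hom G H \<pi> \<longleftrightarrow>
     (\<forall>f\<in>A0 G. \<pi> f \<in> bounded_operators H) \<and>
     (\<forall>f\<in>A0 G. \<forall>g\<in>A0 G. \<forall>\<xi>\<in>carrier H. \<pi> (f + g) \<xi> = \<pi> f \<xi> \<oplus>\<^bsub>H\<^esub> \<pi> g \<xi>) \<and>
     (\<forall>c. \<forall>f\<in>A0 G. \<forall>\<xi>\<in>carrier H. \<pi> (fscale c f) \<xi> = c \<odot>\<^bsub>H\<^esub> \<pi> f \<xi>) \<and>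
     (\<forall>f\<in>A0 G. \<forall>g\<in>A0 G. \<forall>\<xi>\<in>carrier H. \<pi> (conv G f g) \<xi> = \<pi> f (\<pi> g \<xi>))"

definition representation ::
  "'g groupoid_data \<Rightarrow> 'h hilbert \<Rightarrow> (('g \<Rightarrow> complex) \<Rightarrow> 'h \<Rightarrow> 'h) \<Rightarrow> bool" where
  "representation G H \<pi> \<longleftrightarrow>
     algebra_hom G H \<pi> \<and>
     (\<forall>U f. bisection G U \<longrightarrow> f \<in> Cc G U \<longrightarrow> opnorm H (\<pi> f) \<le> sup_norm f) \<and>
     (\<forall>f\<in>Cc G (units G). is_adjoint H (\<pi> f) (\<pi> (\<lambda>x. cnj (f x))))"

definition star_representation ::
  "'g groupoid_data \<Rightarrow> 'h hilbert \<Rightarrow> (('g \<Rightarrow> complex) \<Rightarrow> 'h \<Rightarrow> 'h) \<Rightarrow> bool" where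
  "star_representation G H \<pi> \<longleftrightarrow>
     algebra_hom G H \<pi> \<and> (\<forall>f\<in>A0 G. is_adjoint H (\<pi> f) (\<pi> (star G f)))"

text \<open>
  HOL cannot quantify over types inside a term, so the type \<open>'h\<close> plays the role of a universe: the
  suprema run over all Hilbert spaces carried by some subset of \<open>'h\<close>.  A supremum over all Hilbert
  spaces is already attained by cyclic subrepresentations (closed subspaces generated by one
  vector), so it is the one obtained for any \<open>'h\<close> with at least as many elements as
  \<open>'g \<Rightarrow> complex\<close>.  The suprema are taken in the extended reals, so that no finiteness needs to be
  presupposed; the zero representation shows that the families are nonempty.
\<close>

definition A_seminorm ::
  "'h itself \<Rightarrow> 'g groupoid_data \<Rightarrow> ('g \<Rightarrow> complex) \<Rightarrow> ereal" where
  "A_seminorm _ G f =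
     (SUP (H :: 'h hilbert, \<pi>) \<in> {(H, \<pi>). hilbert_space H \<and> representation G H \<pi>}.
        ereal (opnorm H (\<pi> f)))"

definition Cstar_norm ::
  "'h itself \<Rightarrow> 'g groupoid_data \<Rightarrow> ('g \<Rightarrow> complex) \<Rightarrow> ereal" where
  "Cstar_norm _ G f =
     (SUP (H :: 'h hilbert, \<pi>) \<in> {(H, \<pi>). hilbert_space H \<and> star_representation G H \<pi>}.
        ereal (opnorm H (\<pi> f)))"

end

theory Submission
  imports Defs
begin

text \<open>
  Equality of the two seminorms holds for a reason that has nothing to do with suprema: on a fixed
  Hilbert space the representations are exactly the *-representations.

  A *-representation \<open>\<pi>\<close> is contractive on \<open>Cc G U\<close> for every bisection \<open>U\<close>, whatever the groupoid.
  For \<open>f \<in> Cc G U\<close> the product \<open>g = star f * f\<close> is the function \<open>\<bar>f\<bar>\<^sup>2\<close> carried to the units by the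
  domain map.  If \<open>M\<close> is the supremum norm of \<open>f\<close>, then \<open>k = M - sqrt (M\<^sup>2 - g)\<close> is a real function
  in \<open>Cc G (units G)\<close>, and \<open>(M - k)\<^sup>2 = M\<^sup>2 - g\<close> turns into
  \<open>\<parallel>M \<xi> - \<pi>(k) \<xi>\<parallel>\<^sup>2 = M\<^sup>2 \<parallel>\<xi>\<parallel>\<^sup>2 - \<parallel>\<pi>(f) \<xi>\<parallel>\<^sup>2\<close>.  The left-hand side is nonnegative, which
  bounds \<open>\<pi>(f)\<close> without spectral theory; this is carried out in \<open>star_representation_contractive\<close>.

  Conversely let \<open>\<pi>\<close> be a representation and \<open>U\<close> a compact open bisection.  The indicator functions
  of \<open>U\<close> and of its inverse are mapped to contractions \<open>T\<close> and \<open>S\<close>, whose products \<open>S T\<close> and \<open>T S\<close>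
  come from indicator functions of sets of units and are therefore self-adjoint.  A contraction with
  a contractive inverse is isometric, and this forces \<open>S = T\<^sup>*\<close>
  (\<open>adjoint_of_mutually_inverse_contractions\<close>).  Every \<open>f \<in> Cc G U\<close> is the product of the indicator
  function of \<open>U\<close> with a function on the units, so \<open>\<pi>(star f) = \<pi>(f)\<^sup>*\<close> for such \<open>f\<close>.  Finally, a
  cover by bisections lets one cut any generator of \<open>A0 G\<close> into pieces supported in finitely many of
  them (\<open>A0_subset_span_bisections\<close>), and the identity extends by linearity.
\<close>

section \<open>Operators on a Hilbert space\<close>

context hilbert_space
begin

lemma scale_closed: "x \<in> carrier H \<Longrightarrow> c \<odot>\<^bsub>H\<^esub> x \<in> carrier H"
  by (simp add: complex_ring_def smult_closed)

lemma inner_add_right: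
  assumes "x \<in> carrier H" "y \<in> carrier H" "z \<in> carrier H"
  shows "hinner H x (y \<oplus>\<^bsub>H\<^esub> z) = hinner H x y + hinner H x z"
  using assms inner_commute[of x] inner_add_left[of y z x] by simp

lemma inner_scale_right:
  assumes "x \<in> carrier H" "y \<in> carrier H"
  shows "hinner H x (c \<odot>\<^bsub>H\<^esub> y) = cnj c * hinner H x y"
  using assms inner_commute[of x] inner_scale_left[of y x c] scale_closed by simp

lemma inner_diff_left:
  assumes "x \<in> carrier H" "y \<in> carrier H" "z \<in> carrier H"
  shows "hinner H (x \<ominus>\<^bsub>H\<^esub> y) z = hinner H x z - hinner H y z"
proof -
  have "(x \<ominus>\<^bsub>H\<^esub> y) \<oplus>\<^bsub>H\<^esub> y = x"
    using assms(1,2) by (simp add: M.minus_eq M.add.m_assoc M.l_neg)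
  then show ?thesis
    using inner_add_left[of "x \<ominus>\<^bsub>H\<^esub> y" y z] assms by simp
qed

lemma inner_diff_right:
  assumes "x \<in> carrier H" "y \<in> carrier H" "z \<in> carrier H"
  shows "hinner H x (y \<ominus>\<^bsub>H\<^esub> z) = hinner H x y - hinner H x z"
  using assms inner_commute[of x] inner_diff_left[of y z x] by simp

lemma inner_zero_left: "x \<in> carrier H \<Longrightarrow> hinner H \<zero>\<^bsub>H\<^esub> x = 0"
  using inner_add_left[of "\<zero>\<^bsub>H\<^esub>" "\<zero>\<^bsub>H\<^esub>" x] by simp

lemma inner_self_nonneg: "x \<in> carrier H \<Longrightarrow> Re (hinner H x x) \<ge> 0"
  using inner_pos[of x] inner_zero_left[of x] by (cases "x = \<zero>\<^bsub>H\<^esub>") auto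

lemma hnorm_square: "x \<in> carrier H \<Longrightarrow> (hnorm H x)\<^sup>2 = Re (hinner H x x)"
  by (simp add: hnorm_def inner_self_nonneg)

lemma hnorm_nonneg: "x \<in> carrier H \<Longrightarrow> hnorm H x \<ge> 0"
  by (simp add: hnorm_def inner_self_nonneg)

lemma hnorm_scale:
  assumes "x \<in> carrier H"
  shows "hnorm H (c \<odot>\<^bsub>H\<^esub> x) = cmod c * hnorm H x"
proof -
  have "hinner H (c \<odot>\<^bsub>H\<^esub> x) (c \<odot>\<^bsub>H\<^esub> x) = of_real ((cmod c)\<^sup>2) * hinner H x x"
    using assms unfolding complex_norm_square
    by (simp add: inner_scale_left inner_scale_right scale_closed)
  then show ?thesis
    by (simp add: hnorm_def real_sqrt_mult flip: of_real_power)
qed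

lemma bounded_operators_closed: "T \<in> bounded_operators H \<Longrightarrow> x \<in> carrier H \<Longrightarrow> T x \<in> carrier H"
  by (auto simp: bounded_operators_def)

lemma hnorm_le_opnorm:
  assumes T: "T \<in> bounded_operators H" and x: "x \<in> carrier H"
  shows "hnorm H (T x) \<le> opnorm H T * hnorm H x"
proof -
  let ?B = "{x \<in> carrier H. hnorm H x \<le> 1}"
  obtain C where C: "\<And>x. x \<in> carrier H \<Longrightarrow> hnorm H (T x) \<le> C * hnorm H x"
    using T unfolding bounded_operators_def by blast
  have bdd: "bdd_above ((\<lambda>x. hnorm H (T x)) ` ?B)"
  proof (rule bdd_aboveI2)
    fix y assume y: "y \<in> ?B"
    then have "C * hnorm H y \<le> \<bar>C\<bar> * 1"
      by (intro mult_mono) (auto simp: hnorm_nonneg)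
    then show "hnorm H (T y) \<le> \<bar>C\<bar>"
      using C[of y] y by simp
  qed
  show ?thesis
  proof (cases "hnorm H x = 0")
    case True
    then show ?thesis using C[OF x] by simp
  next
    case False
    then have pos: "hnorm H x > 0" using hnorm_nonneg[OF x] by simp
    define c where "c = complex_of_real (inverse (hnorm H x))"
    have cx: "c \<odot>\<^bsub>H\<^esub> x \<in> ?B"
      using x pos by (simp add: scale_closed hnorm_scale c_def norm_inverse)
    have "hnorm H (T (c \<odot>\<^bsub>H\<^esub> x)) \<le> opnorm H T"
      unfolding opnorm_def by (rule cSUP_upper[OF cx bdd])
    moreover have "T (c \<odot>\<^bsub>H\<^esub> x) = c \<odot>\<^bsub>H\<^esub> T x"
      using T x by (auto simp: bounded_operators_def)
    ultimately have "inverse (hnorm H x) * hnorm H (T x) \<le> opnorm H T"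
      using pos bounded_operators_closed[OF T x] by (simp add: hnorm_scale c_def norm_inverse)
    then show ?thesis
      using pos by (simp add: field_simps)
  qed
qed

lemma opnorm_le:
  assumes "0 \<le> B" "\<And>x. x \<in> carrier H \<Longrightarrow> hnorm H (T x) \<le> B * hnorm H x"
  shows "opnorm H T \<le> B"
  unfolding opnorm_def
proof (rule cSUP_least)
  have "\<zero>\<^bsub>H\<^esub> \<in> {x \<in> carrier H. hnorm H x \<le> 1}"
    by (simp add: hnorm_def inner_zero_left)
  then show "{x \<in> carrier H. hnorm H x \<le> 1} \<noteq> {}" by blast
next
  fix x assume x: "x \<in> {x \<in> carrier H. hnorm H x \<le> 1}"
  then have "B * hnorm H x \<le> B * 1"
    using assms(1) by (intro mult_left_mono) auto
  then show "hnorm H (T x) \<le> B" using assms(2)[of x] x by simp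
qed

text \<open>
  Polarization: expanding \<open>\<parallel>A (x + y)\<parallel>\<^sup>2\<close> recovers the real part of the inner product from norms, and
  replacing \<open>x\<close> by \<open>\<i> x\<close> recovers the imaginary part.
\<close>

lemma inner_eq_of_hnorm_eq:
  assumes A: "A \<in> bounded_operators H" and B: "B \<in> bounded_operators H"
    and eq: "\<And>x. x \<in> carrier H \<Longrightarrow> hnorm H (A x) = hnorm H (B x)"
    and x: "x \<in> carrier H" and y: "y \<in> carrier H"
  shows "hinner H (A x) (A y) = hinner H (B x) (B y)"
proof -
  note closed = bounded_operators_closed[OF A] bounded_operators_closed[OF B]
  have expand: "(hnorm H (T (u \<oplus>\<^bsub>H\<^esub> v)))\<^sup>2
      = (hnorm H (T u))\<^sup>2 + 2 * Re (hinner H (T u) (T v)) + (hnorm H (T v))\<^sup>2"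
    if T: "T \<in> bounded_operators H" and uv: "u \<in> carrier H" "v \<in> carrier H" for T u v
  proof -
    have "T (u \<oplus>\<^bsub>H\<^esub> v) = T u \<oplus>\<^bsub>H\<^esub> T v"
      using T uv by (auto simp: bounded_operators_def)
    moreover have "Re (hinner H (T v) (T u)) = Re (hinner H (T u) (T v))"
      using inner_commute[of "T v" "T u"] bounded_operators_closed[OF T] uv by simp
    ultimately show ?thesis
      using bounded_operators_closed[OF T] uv
      by (simp add: hnorm_square inner_add_left inner_add_right)
  qed
  have re: "Re (hinner H (A u) (A v)) = Re (hinner H (B u) (B v))"
    if "u \<in> carrier H" "v \<in> carrier H" for u v
    using expand[OF A that] expand[OF B that] eq[of u] eq[of v] eq[of "u \<oplus>\<^bsub>H\<^esub> v"] that
    by simp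
  have scale: "T (\<i> \<odot>\<^bsub>H\<^esub> x) = \<i> \<odot>\<^bsub>H\<^esub> T x" if "T \<in> bounded_operators H" for T
    using that x by (auto simp: bounded_operators_def)
  have "Im (hinner H (A x) (A y)) = Im (hinner H (B x) (B y))"
    using re[of "\<i> \<odot>\<^bsub>H\<^esub> x" y] x y closed
    by (simp add: scale_closed scale[OF A] scale[OF B] inner_scale_left)
  then show ?thesis
    using re[OF x y] by (simp add: complex_eq_iff)
qed

text \<open>
  The operators \<open>T\<close> and \<open>S\<close> are inverse to each other between the ranges of \<open>P\<close> and \<open>Q\<close>.  Neither
  increases norms, so \<open>T\<close> is isometric on the range of \<open>P\<close>, where it therefore preserves inner products
  by polarization.  Moving \<open>Q\<close> and then \<open>P\<close> across the inner product yields the adjoint relation.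
\<close>

lemma adjoint_of_mutually_inverse_contractions:
  assumes T: "T \<in> bounded_operators H" and S: "S \<in> bounded_operators H"
    and P: "P \<in> bounded_operators H" and Q: "Q \<in> bounded_operators H"
    and norm_T: "\<And>x. x \<in> carrier H \<Longrightarrow> hnorm H (T x) \<le> hnorm H x"
    and norm_S: "\<And>x. x \<in> carrier H \<Longrightarrow> hnorm H (S x) \<le> hnorm H x"
    and ST: "\<And>x. x \<in> carrier H \<Longrightarrow> S (T x) = P x"
    and TS: "\<And>x. x \<in> carrier H \<Longrightarrow> T (S x) = Q x"
    and TP: "\<And>x. x \<in> carrier H \<Longrightarrow> T (P x) = T x"
    and QT: "\<And>x. x \<in> carrier H \<Longrightarrow> Q (T x) = T x"
    and PS: "\<And>x. x \<in> carrier H \<Longrightarrow> P (S x) = S x"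
    and adj_P: "is_adjoint H P P" and adj_Q: "is_adjoint H Q Q"
  shows "is_adjoint H T S"
  unfolding is_adjoint_def
proof (intro ballI)
  fix x y assume x: "x \<in> carrier H" and y: "y \<in> carrier H"
  note [simp] = bounded_operators_closed[OF T] bounded_operators_closed[OF S]
    bounded_operators_closed[OF P] bounded_operators_closed[OF Q]
  have isometric: "hnorm H (T z) = hnorm H (P z)" if "z \<in> carrier H" for z
    using norm_T[of "P z"] norm_S[of "T z"] that by (simp add: TP ST)
  have "hinner H (T x) y = hinner H (Q (T x)) y"
    using x by (simp add: QT)
  also have "\<dots> = hinner H (T x) (Q y)"
    using adj_Q x y by (simp add: is_adjoint_def)
  also have "\<dots> = hinner H (T x) (T (S y))"
    using y by (simp add: TS)
  also have "\<dots> = hinner H (P x) (P (S y))"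
    using x y by (intro inner_eq_of_hnorm_eq[OF T P isometric]) auto
  also have "\<dots> = hinner H x (P (P (S y)))"
    using adj_P x y by (simp add: is_adjoint_def)
  finally show "hinner H (T x) y = hinner H x (S y)"
    using y by (simp add: PS)
qed

text \<open>
  The hypothesis says that \<open>\<parallel>M x - k\<parallel>\<^sup>2 = M\<^sup>2 \<parallel>x\<parallel>\<^sup>2 - \<parallel>a\<parallel>\<^sup>2\<close>.
\<close>

lemma hnorm_le_of_inner_identity:
  fixes M :: real
  assumes "x \<in> carrier H" "a \<in> carrier H" "k \<in> carrier H" "0 \<le> M"
    and "Re (hinner H a a) + Re (hinner H k k) = 2 * M * Re (hinner H x k)"
  shows "hnorm H a \<le> M * hnorm H x"
proof -
  let ?Mx = "complex_of_real M \<odot>\<^bsub>H\<^esub> x"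
  have [simp]: "?Mx \<in> carrier H" using assms by (simp add: scale_closed)
  have "hinner H k x = cnj (hinner H x k)"
    using assms inner_commute by blast
  then have "Re (hinner H (?Mx \<ominus>\<^bsub>H\<^esub> k) (?Mx \<ominus>\<^bsub>H\<^esub> k))
      = M\<^sup>2 * Re (hinner H x x) - 2 * M * Re (hinner H x k) + Re (hinner H k k)"
    using assms(1,3)
    by (simp add: inner_diff_left inner_diff_right inner_scale_left inner_scale_right power2_eq_square)
      (simp add: algebra_simps)
  then have "Re (hinner H a a) \<le> M\<^sup>2 * Re (hinner H x x)"
    using inner_self_nonneg[of "?Mx \<ominus>\<^bsub>H\<^esub> k"] assms by simp
  then have "(hnorm H a)\<^sup>2 \<le> (M * hnorm H x)\<^sup>2"
    using assms by (simp add: power_mult_distrib hnorm_square)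
  then show ?thesis
    by (rule power2_le_imp_le) (use assms hnorm_nonneg[of x] in simp)
qed

end

section \<open>Local homeomorphisms and compactly supported functions\<close>

lemma local_homeomorphism_map_imp_continuous_map:
  assumes "local_homeomorphism_map X Y f"
  shows "continuous_map X Y f"
proof -
  have "\<exists>U. openin X U \<and> x \<in> U \<and> continuous_map (subtopology X U) Y f"
    if "x \<in> topspace X" for x
    using assms that unfolding local_homeomorphism_map_def
    by (meson continuous_map_into_fulltopology homeomorphic_imp_continuous_map)
  then obtain U where U: "\<And>x. x \<in> topspace X \<Longrightarrow>
      openin X (U x) \<and> x \<in> U x \<and> continuous_map (subtopology X (U x)) Y f"
    by metis
  show ?thesis
    by (rule pasting_lemma[where I = "topspace X" and T = U and f = "\<lambda>_. f"]) (use U in auto)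
qed

text \<open>
  An open set meets each chart in a set with open image, and these images exhaust the image.
\<close>

lemma local_homeomorphism_map_imp_open_map:
  assumes "local_homeomorphism_map X Y f"
  shows "open_map X Y f"
  unfolding open_map_def
proof (intro allI impI)
  fix V assume V: "openin X V"
  show "openin Y (f ` V)"
  proof (subst openin_subopen, intro ballI)
    fix y assume "y \<in> f ` V"
    then obtain x where x: "x \<in> V" "y = f x" by blast
    then have "x \<in> topspace X" using V openin_subset by blast
    then obtain U where U: "openin X U" "x \<in> U" "openin Y (f ` U)"
      "homeomorphic_map (subtopology X U) (subtopology Y (f ` U)) f"
      using assms unfolding local_homeomorphism_map_def by blast
    have "openin (subtopology X U) (V \<inter> U)"
      using V openin_subtopology_Int by blast
    then have "openin (subtopology Y (f ` U)) (f ` (V \<inter> U))"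
      using homeomorphic_imp_open_map[OF U(4)] unfolding open_map_def by blast
    then have "openin Y (f ` (V \<inter> U))"
      using U(3) by (simp add: openin_open_subtopology)
    then show "\<exists>T. openin Y T \<and> y \<in> T \<and> T \<subseteq> f ` V"
      using x U(2) by blast
  qed
qed

lemma Cc_zero_outside: "f \<in> Cc G V \<Longrightarrow> x \<notin> V \<Longrightarrow> f x = 0"
  by (simp add: Cc_def)

lemma Cc_continuous: "f \<in> Cc G V \<Longrightarrow> continuous_map (subtopology (gtop G) V) euclidean f"
  by (simp add: Cc_def)

lemma Cc_compact_support:
  assumes "f \<in> Cc G V" "V \<subseteq> arrows G"
  obtains K where "compactin (gtop G) K" "K \<subseteq> V" "\<And>x. f x \<noteq> 0 \<Longrightarrow> x \<in> K"
proof
  let ?X = "subtopology (gtop G) V"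
  let ?K = "?X closure_of {x \<in> V. f x \<noteq> 0}"
  have "compactin ?X ?K"
    using assms(1) by (simp add: Cc_def)
  then show "compactin (gtop G) ?K" "?K \<subseteq> V"
    by (auto simp: compactin_subtopology)
  show "x \<in> ?K" if "f x \<noteq> 0" for x
  proof -
    have "{x \<in> V. f x \<noteq> 0} \<subseteq> ?K"
      using assms(2) by (intro closure_of_subset) (auto simp: arrows_def)
    then show ?thesis
      using that Cc_zero_outside[OF assms(1)] by auto
  qed
qed

text \<open>
  In a Hausdorff space a compact set is closed, so any compact set that contains all nonzero points
  also contains their closure.
\<close>

lemma CcI:
  assumes "Hausdorff_space (subtopology (gtop G) V)"
    and "continuous_map (subtopology (gtop G) V) euclidean f"
    and K: "compactin (gtop G) K" "K \<subseteq> V" "\<And>x. f x \<noteq> 0 \<Longrightarrow> x \<in> K"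
  shows "f \<in> Cc G V"
proof -
  let ?X = "subtopology (gtop G) V"
  have cK: "compactin ?X K"
    using K by (simp add: compactin_subtopology)
  then have "?X closure_of {x \<in> V. f x \<noteq> 0} \<subseteq> K"
    using K(3) by (intro closure_of_minimal compactin_imp_closedin assms) auto
  then have "compactin ?X (?X closure_of {x \<in> V. f x \<noteq> 0})"
    by (rule closed_compactin[OF cK _ closedin_closure_of])
  moreover have "f x = 0" if "x \<notin> V" for x
    using that K(2) K(3)[of x] by blast
  ultimately show ?thesis
    using assms(2) by (simp add: Cc_def)
qed

lemma Cc_of_support_subset:
  assumes f: "f \<in> Cc G V"
    and h: "continuous_map (subtopology (gtop G) V) euclidean h"
    and supp: "\<And>x. h x \<noteq> 0 \<Longrightarrow> f x \<noteq> 0"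
  shows "h \<in> Cc G V"
proof -
  let ?X = "subtopology (gtop G) V"
  have "?X closure_of {x \<in> V. h x \<noteq> 0} \<subseteq> ?X closure_of {x \<in> V. f x \<noteq> 0}"
    using supp by (intro closure_of_mono) auto
  then have "compactin ?X (?X closure_of {x \<in> V. h x \<noteq> 0})"
    by (rule closed_compactin[rotated]) (use f in \<open>simp_all add: Cc_def\<close>)
  moreover have "h x = 0" if "x \<notin> V" for x
    using supp Cc_zero_outside[OF f that] by blast
  ultimately show ?thesis
    using h by (simp add: Cc_def)
qed

lemma continuous_map_comp_UNIV:
  assumes "continuous_map X euclidean f" "continuous_on UNIV g"
  shows "continuous_map X euclidean (\<lambda>x. g (f x))"
  using continuous_map_compose[OF assms(1), of euclidean g] assms(2)
  by (simp add: o_def)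

lemma Cc_comp:
  assumes f: "f \<in> Cc G V" and "continuous_on UNIV \<phi>" "\<phi> 0 = 0"
  shows "(\<lambda>x. \<phi> (f x)) \<in> Cc G V"
  using assms continuous_map_comp_UNIV[OF Cc_continuous[OF f], of \<phi>]
  by (intro Cc_of_support_subset[OF f]) auto

text \<open>
  The Hausdorff property of the larger set makes the compact support closed in it, and therefore the
  extension by zero continuous.
\<close>

lemma Cc_extend_by_zero:
  assumes f: "f \<in> Cc G V" and V: "openin (gtop G) V" "V \<subseteq> W"
    and W: "Hausdorff_space (subtopology (gtop G) W)"
  shows "f \<in> Cc G W"
proof -
  let ?X = "subtopology (gtop G) W"
  have "V \<subseteq> arrows G"
    using V(1) openin_subset unfolding arrows_def by blast
  then obtain K where K: "compactin (gtop G) K" "K \<subseteq> V" "\<And>x. f x \<noteq> 0 \<Longrightarrow> x \<in> K"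
    using Cc_compact_support[OF f] by blast
  have "closedin ?X K"
    using K V(2) by (intro compactin_imp_closedin W) (auto simp: compactin_subtopology)
  then have opn: "openin ?X (topspace ?X - K)"
    by blast
  \<comment> \<open>\<open>f\<close> is continuous on each of the open sets \<open>V\<close> and \<open>W - K\<close>, being zero on the latter\<close>
  have "continuous_map ?X euclidean f"
  proof (rule pasting_lemma[where I = "{True, False}" and f = "\<lambda>_. f"
        and T = "\<lambda>b. if b then V else topspace ?X - K"])
    show "openin ?X (if b then V else topspace ?X - K)" for b
    proof -
      have "openin ?X V"
        unfolding openin_subtopology using V by (metis inf.absorb1)
      then show ?thesis using opn by simp
    qed
    show "continuous_map (subtopology ?X (if b then V else topspace ?X - K)) euclidean f" for b
    proof (cases b)
      case True
      then show ?thesis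
        using Cc_continuous[OF f] V(2) by (simp add: subtopology_subtopology inf.absorb2)
    next
      case False
      have "continuous_map (subtopology ?X (topspace ?X - K)) euclidean (\<lambda>_. 0 :: complex)"
        by simp
      then have "continuous_map (subtopology ?X (topspace ?X - K)) euclidean f"
      proof (rule continuous_map_eq)
        fix x assume "x \<in> topspace (subtopology ?X (topspace ?X - K))"
        then have "x \<notin> K" by simp
        then show "0 = f x" using K(3)[of x] by metis
      qed
      then show ?thesis using False by simp
    qed
    show "\<exists>j. j \<in> {True, False} \<and> x \<in> (if j then V else topspace ?X - K) \<and> f x = f x"
      if "x \<in> topspace ?X" for x
      using that K(2) by (cases "x \<in> V") auto
  qed simp
  then show ?thesis
  proof (rule CcI[OF W _ K(1)])
    show "K \<subseteq> W" using K(2) V(2) by blast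
  qed (fact K(3))
qed

text \<open>
  This serves both for the inversion and for the domain map on a bisection.  Only \<open>\<psi>\<close> occurs in the
  transported function; \<open>\<phi>\<close> certifies that supports go to compact sets.
\<close>

lemma Cc_transport:
  assumes \<psi>: "homeomorphic_maps (subtopology (gtop G) V) (subtopology (gtop G) W) \<phi> \<psi>"
    and f: "f \<in> Cc G V" and V: "V \<subseteq> arrows G" and W: "W \<subseteq> arrows G"
  shows "(\<lambda>z. if z \<in> W then f (\<psi> z) else 0) \<in> Cc G W"
proof -
  let ?X = "subtopology (gtop G) V" and ?Y = "subtopology (gtop G) W"
  let ?h = "\<lambda>z. if z \<in> W then f (\<psi> z) else 0"
  have top: "topspace ?X = V" "topspace ?Y = W"
    using V W by (auto simp: arrows_def)
  have maps: "\<And>x. x \<in> V \<Longrightarrow> \<phi> x \<in> W \<and> \<psi> (\<phi> x) = x" "\<And>y. y \<in> W \<Longrightarrow> \<psi> y \<in> V \<and> \<phi> (\<psi> y) = y"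
    using \<psi> top unfolding homeomorphic_maps_def continuous_map_def by auto
  have hom: "homeomorphic_map ?X ?Y \<phi>"
    using \<psi> homeomorphic_map_maps by blast
  have "continuous_map ?Y euclidean (f \<circ> \<psi>)"
    by (rule continuous_map_compose[OF _ Cc_continuous[OF f]])
      (use \<psi> in \<open>simp add: homeomorphic_maps_def\<close>)
  then have cont: "continuous_map ?Y euclidean ?h"
    by (rule continuous_map_eq) (simp add: top)
  have "{z \<in> W. ?h z \<noteq> 0} = \<phi> ` {x \<in> V. f x \<noteq> 0}"
  proof (intro equalityI subsetI)
    fix z assume "z \<in> {z \<in> W. ?h z \<noteq> 0}"
    then have "\<psi> z \<in> {x \<in> V. f x \<noteq> 0}" "z = \<phi> (\<psi> z)"
      using maps(2)[of z] by (simp_all split: if_splits)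
    then show "z \<in> \<phi> ` {x \<in> V. f x \<noteq> 0}" by blast
  qed (use maps(1) in auto)
  then have "?Y closure_of {z \<in> W. ?h z \<noteq> 0} = \<phi> ` (?X closure_of {x \<in> V. f x \<noteq> 0})"
    using homeomorphic_map_closure_of[OF hom, of "{x \<in> V. f x \<noteq> 0}"] by (simp only: top) simp
  moreover have "compactin ?Y (\<phi> ` (?X closure_of {x \<in> V. f x \<noteq> 0}))"
    by (rule image_compactin[OF _ homeomorphic_imp_continuous_map[OF hom]])
      (use f in \<open>simp add: Cc_def\<close>)
  ultimately show ?thesis
    using cont by (simp add: Cc_def)
qed

lemma Cc_le_sup_norm:
  assumes f: "f \<in> Cc G V" and V: "V \<subseteq> arrows G"
  shows "cmod (f x) \<le> sup_norm f"
  unfolding sup_norm_def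
proof (rule cSUP_upper)
  obtain K where K: "compactin (gtop G) K" "K \<subseteq> V" "\<And>x. f x \<noteq> 0 \<Longrightarrow> x \<in> K"
    using Cc_compact_support[OF f V] by blast
  have "compactin euclidean (f ` K)"
    using K by (intro image_compactin[OF _ Cc_continuous[OF f]]) (auto simp: compactin_subtopology)
  then have "bounded (f ` K)"
    by (simp add: compact_imp_bounded)
  then obtain B where B: "\<And>y. y \<in> K \<Longrightarrow> cmod (f y) \<le> B"
    unfolding bounded_iff by blast
  show "bdd_above (range (\<lambda>x. cmod (f x)))"
  proof (rule bdd_aboveI2)
    show "cmod (f y) \<le> max B 0" for y
      using B[of y] K(3)[of y] by (cases "f y = 0") auto
  qed
qed simp

lemma indicator_mem_Cc:
  assumes "compactin (gtop G) U"
  shows "(indicator U :: 'g \<Rightarrow> complex) \<in> Cc G U"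
proof -
  let ?X = "subtopology (gtop G) U"
  have sub: "U \<subseteq> topspace (gtop G)"
    using assms compactin_subset_topspace by blast
  have "continuous_map ?X euclidean (\<lambda>_. 1 :: complex)"
    by simp
  then have cont: "continuous_map ?X euclidean (indicator U :: 'g \<Rightarrow> complex)"
    by (rule continuous_map_eq) (auto simp: indicator_def)
  have "{x \<in> U. (indicator U x :: complex) \<noteq> 0} = U"
    by (auto simp: indicator_def)
  moreover have "?X closure_of U = U"
    using closure_of_topspace[of ?X] sub by (simp add: inf.absorb2)
  ultimately show ?thesis
    using assms cont by (simp add: Cc_def compactin_subtopology)
qed

lemma sup_norm_indicator_le_1: "sup_norm (indicator U) \<le> 1"
  unfolding sup_norm_def by (rule cSUP_least) (auto simp: indicator_def)

lemma Cc_subset_A0: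
  assumes "openin (gtop G) V" "Hausdorff_space (subtopology (gtop G) V)"
  shows "Cc G V \<subseteq> A0 G"
  unfolding A0_def using assms by (intro subsetI cfun.span_base) blast

text \<open>
  Truncating \<open>\<phi>\<close> below at the level 1 moves the support of the cutoff into \<open>{\<phi> \<ge> 1}\<close>, which is closed
  and whose intersection with \<open>K\<close> stays inside \<open>U\<close>; the set \<open>{\<phi> \<noteq> 0}\<close> itself could accumulate
  outside \<open>U\<close>.
\<close>

lemma Cc_cutoff:
  assumes V: "openin (gtop G) V" "Hausdorff_space (subtopology (gtop G) V)"
    and U: "openin (gtop G) U" "U \<subseteq> V"
    and f: "f \<in> Cc G V" and K: "compactin (gtop G) K" "K \<subseteq> V" "\<And>x. f x \<noteq> 0 \<Longrightarrow> x \<in> K"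
    and \<phi>: "continuous_map (subtopology (gtop G) V) euclideanreal \<phi>"
    and zero: "\<And>x. x \<in> K \<Longrightarrow> x \<notin> U \<Longrightarrow> \<phi> x = 0"
  shows "(\<lambda>x. complex_of_real (min 1 (max 0 (\<phi> x - 1))) * f x) \<in> Cc G U"
proof -
  let ?X = "subtopology (gtop G) V"
  let ?h = "\<lambda>x. complex_of_real (min 1 (max 0 (\<phi> x - 1))) * f x"
  have "continuous_map ?X euclidean (\<lambda>x. complex_of_real (min 1 (max 0 (\<phi> x - 1))))"
    by (rule continuous_map_comp_UNIV[OF \<phi>]) (intro continuous_intros)
  then have "continuous_map ?X euclidean ?h"
    using Cc_continuous[OF f] by (simp add: continuous_map_atin tendsto_mult)
  then have cont: "continuous_map (subtopology (gtop G) U) euclidean ?h"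
    using U continuous_map_from_subtopology_mono by blast
  have "closedin ?X {x \<in> topspace ?X. \<phi> x \<in> {1..}}"
    using \<phi> by (rule closedin_continuous_map_preimage) auto
  moreover have cK: "compactin ?X K"
    using K by (simp add: compactin_subtopology)
  ultimately have "closedin ?X (K \<inter> {x \<in> topspace ?X. \<phi> x \<in> {1..}})"
    using compactin_imp_closedin[OF V(2)] by blast
  then have "compactin ?X (K \<inter> {x \<in> topspace ?X. \<phi> x \<in> {1..}})"
    by (rule closed_compactin[OF cK, rotated]) blast
  then have L: "compactin (gtop G) (K \<inter> {x \<in> topspace ?X. \<phi> x \<in> {1..}})"
    by (simp add: compactin_subtopology)
  have "Hausdorff_space (subtopology ?X U)"
    using V(2) Hausdorff_space_subtopology by blast
  then have "Hausdorff_space (subtopology (gtop G) U)"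
    using U(2) by (simp add: subtopology_subtopology inf.absorb2)
  then show ?thesis
  proof (rule CcI[OF _ cont L])
    show "K \<inter> {x \<in> topspace ?X. \<phi> x \<in> {1..}} \<subseteq> U"
    proof
      fix x assume "x \<in> K \<inter> {x \<in> topspace ?X. \<phi> x \<in> {1..}}"
      then show "x \<in> U" using zero[of x] by (cases "x \<in> U") simp_all
    qed
    show "x \<in> K \<inter> {x \<in> topspace ?X. \<phi> x \<in> {1..}}" if "?h x \<noteq> 0" for x
    proof -
      have "x \<in> K" using that K(3) by simp
      moreover have "\<phi> x \<ge> 1" using that by (simp add: max_def min_def split: if_splits)
      ultimately show ?thesis
        using K(2) openin_subset[OF V(1)] by auto
    qed
  qed
qed

section \<open>Convolution and involution on a groupoid\<close>

text \<open>
  This is \<open>f\<close> carried along the domain map.  It is only meaningful when \<open>gdom G\<close> is injective on \<open>U\<close>, so that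
  \<open>inv_into\<close> selects the unique arrow of \<open>U\<close> over \<open>z\<close>.
\<close>

definition dom_push :: "'g groupoid_data \<Rightarrow> 'g set \<Rightarrow> ('g \<Rightarrow> complex) \<Rightarrow> 'g \<Rightarrow> complex" where
  "dom_push G U f z = (if z \<in> gdom G ` U then f (inv_into U (gdom G) z) else 0)"

context topological_groupoid
begin

lemma dom_mem_units: "x \<in> arrows G \<Longrightarrow> gdom G x \<in> units G"
  by (simp add: units_def)

lemma unit_arrow: "u \<in> units G \<Longrightarrow> u \<in> arrows G"
  by (auto simp: units_def dom_closed)

lemma dom_unit: "u \<in> units G \<Longrightarrow> gdom G u = u"
  by (auto simp: units_def dom_dom)

lemma ran_unit: "u \<in> units G \<Longrightarrow> gran G u = u"
  by (auto simp: units_def ran_dom)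

lemma composable_iff: "(x, y) \<in> composable G \<longleftrightarrow> x \<in> arrows G \<and> y \<in> arrows G \<and> gdom G x = gran G y"
  by (simp add: composable_def)

lemma inv_inv:
  assumes x: "x \<in> arrows G"
  shows "ginv G (ginv G x) = x"
proof -
  have inv: "ginv G x \<in> arrows G" "ginv G (ginv G x) \<in> arrows G"
    using x inv_closed by auto
  have comp: "(ginv G (ginv G x), ginv G x) \<in> composable G" "(ginv G x, x) \<in> composable G"
    using x inv by (simp_all add: composable_iff dom_inv)
  have "ginv G (ginv G x) = gmult G (ginv G (ginv G x)) (gmult G (ginv G x) x)"
    using mult_dom[OF inv(2)] x inv by (simp add: inv_mult dom_inv ran_inv)
  also have "\<dots> = gmult G (gmult G (ginv G (ginv G x)) (ginv G x)) x"
    using mult_assoc[OF comp] by simp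
  also have "\<dots> = x"
    using x inv by (simp add: inv_mult dom_inv ran_mult_left)
  finally show ?thesis .
qed

lemma inv_unit:
  assumes "u \<in> units G"
  shows "ginv G u = u"
proof -
  have u: "u \<in> arrows G" using assms unit_arrow by blast
  then have "gmult G (ginv G u) u = ginv G u"
    using mult_dom[OF inv_closed[OF u]] assms by (simp add: dom_inv ran_unit)
  then show ?thesis
    using inv_mult[OF u] assms by (simp add: dom_unit)
qed

lemma inv_image_inv: "U \<subseteq> arrows G \<Longrightarrow> ginv G ` (ginv G ` U) = U"
  unfolding image_image by (subst image_cong[OF refl, of U _ "\<lambda>x. x"]) (auto simp: inv_inv)

text \<open>
  A product \<open>x y = z\<close> in which \<open>x\<close> is a unit has \<open>y = z\<close> and \<open>x = gran G z\<close>, so the sum that defines the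
  convolution has at most one nonzero term.
\<close>

lemma conv_units_left:
  assumes h: "\<And>x. x \<notin> units G \<Longrightarrow> h x = 0" and g: "\<And>x. x \<notin> arrows G \<Longrightarrow> g x = 0"
  shows "conv G h g z = h (gran G z) * g z"
proof -
  let ?S = "{(x, y) \<in> composable G. gmult G x y = z}"
  let ?T = "if z \<in> arrows G then {(gran G z, z)} else {}"
  have "conv G h g z = (\<Sum>\<^sub>\<infinity>(x, y)\<in>?T. h x * g y)"
    unfolding conv_def
  proof (rule infsum_cong_neutral)
    show "(case p of (x, y) \<Rightarrow> h x * g y) = 0" if "p \<in> ?T - ?S" for p
      using that by (auto simp: composable_iff ran_closed dom_ran ran_mult_left split: if_splits)
    show "(case p of (x, y) \<Rightarrow> h x * g y) = 0" if p: "p \<in> ?S - ?T" for p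
    proof (cases p)
      case (Pair x y)
      have xy: "(x, y) \<in> composable G" "gmult G x y = z"
        using p Pair by auto
      have "x \<notin> units G"
      proof
        assume "x \<in> units G"
        then have "x = gran G y"
          using xy by (simp add: composable_iff dom_unit)
        then have "y = z" "x = gran G z" "z \<in> arrows G"
          using xy ran_mult_left[of y] by (auto simp: composable_iff)
        then show False using p Pair by simp
      qed
      then show ?thesis using h Pair by simp
    qed
  qed simp
  then show ?thesis using g by (simp split: if_splits)
qed

lemma conv_units_right:
  assumes f: "\<And>x. x \<notin> arrows G \<Longrightarrow> f x = 0" and h: "\<And>x. x \<notin> units G \<Longrightarrow> h x = 0"
  shows "conv G f h z = f z * h (gdom G z)"
proof -
  let ?S = "{(x, y) \<in> composable G. gmult G x y = z}"
  let ?T = "if z \<in> arrows G then {(z, gdom G z)} else {}"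
  have "conv G f h z = (\<Sum>\<^sub>\<infinity>(x, y)\<in>?T. f x * h y)"
    unfolding conv_def
  proof (rule infsum_cong_neutral)
    show "(case p of (x, y) \<Rightarrow> f x * h y) = 0" if "p \<in> ?T - ?S" for p
      using that by (auto simp: composable_iff dom_closed ran_dom mult_dom split: if_splits)
    show "(case p of (x, y) \<Rightarrow> f x * h y) = 0" if p: "p \<in> ?S - ?T" for p
    proof (cases p)
      case (Pair x y)
      have xy: "(x, y) \<in> composable G" "gmult G x y = z"
        using p Pair by auto
      have "y \<notin> units G"
      proof
        assume "y \<in> units G"
        then have "y = gdom G x"
          using xy by (simp add: composable_iff ran_unit)
        then have "x = z" "y = gdom G z" "z \<in> arrows G"
          using xy mult_dom[of x] by (auto simp: composable_iff)
        then show False using p Pair by simp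
      qed
      then show ?thesis using h Pair by simp
    qed
  qed simp
  then show ?thesis using f by (simp split: if_splits)
qed

text \<open>
  A nonzero term of the sum comes from \<open>x y = z\<close> with \<open>ginv G x\<close> and \<open>y\<close> both in \<open>U\<close>.  They have the same range,
  so they coincide by injectivity of \<open>gran G\<close>, and \<open>z = gdom G y\<close>.  Injectivity of \<open>gdom G\<close> then
  determines \<open>y\<close> from \<open>z\<close>.
\<close>

lemma conv_star_self:
  assumes U: "U \<subseteq> arrows G" "inj_on (gdom G) U" "inj_on (gran G) U"
    and f: "\<And>x. x \<notin> U \<Longrightarrow> f x = 0"
  shows "conv G (star G f) f = dom_push G U (\<lambda>x. complex_of_real ((cmod (f x))\<^sup>2))"
proof
  fix z
  let ?S = "{(x, y) \<in> composable G. gmult G x y = z}"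
  let ?T = "if z \<in> gdom G ` U then {(ginv G (inv_into U (gdom G) z), inv_into U (gdom G) z)} else {}"
  have "conv G (star G f) f z = (\<Sum>\<^sub>\<infinity>(x, y)\<in>?T. star G f x * f y)"
    unfolding conv_def
  proof (rule infsum_cong_neutral)
    show "(case p of (x, y) \<Rightarrow> star G f x * f y) = 0" if "p \<in> ?T - ?S" for p
    proof -
      from that obtain w where w: "w \<in> U" "z = gdom G w" "p = (ginv G w, w)"
        using U(2) by (auto split: if_splits)
      then have "p \<in> ?S"
        using U(1) by (auto simp: composable_iff inv_closed dom_inv inv_mult)
      then show ?thesis using that by blast
    qed
    show "(case p of (x, y) \<Rightarrow> star G f x * f y) = 0" if p: "p \<in> ?S - ?T" for p
    proof (rule ccontr, cases p)
      case (Pair x y)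
      assume "(case p of (x, y) \<Rightarrow> star G f x * f y) \<noteq> 0"
      then have nz: "star G f x \<noteq> 0" "f y \<noteq> 0" using Pair by auto
      have xy: "x \<in> arrows G" "y \<in> arrows G" "gdom G x = gran G y" "gmult G x y = z"
        using p Pair by (auto simp: composable_iff)
      have inU: "ginv G x \<in> U" "y \<in> U"
        using nz f xy(1) by (auto simp: star_def)
      then have "ginv G x = y"
        using U(3) xy ran_inv[of x] by (auto dest: inj_onD)
      then have "x = ginv G y" using xy(1) inv_inv by metis
      moreover from this have "z = gdom G y" using xy inv_mult by metis
      ultimately have "p \<in> ?T" using Pair inU(2) U(2) by simp
      then show False using p by blast
    qed
  qed simp
  also have "\<dots> = dom_push G U (\<lambda>x. complex_of_real ((cmod (f x))\<^sup>2)) z"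
  proof (cases "z \<in> gdom G ` U")
    case True
    define w where "w = inv_into U (gdom G) z"
    have w: "w \<in> arrows G"
      using subsetD[OF U(1) inv_into_into[OF True]] by (simp add: w_def)
    then have "star G f (ginv G w) = cnj (f w)"
      by (simp add: star_def inv_closed inv_inv)
    then show ?thesis
      using True by (simp only: dom_push_def w_def complex_norm_square) (simp add: mult.commute)
  next
    case False
    then show ?thesis by (simp add: dom_push_def)
  qed
  finally show "conv G (star G f) f z = dom_push G U (\<lambda>x. complex_of_real ((cmod (f x))\<^sup>2)) z" .
qed

lemma homeomorphic_maps_inv: "homeomorphic_maps (gtop G) (gtop G) (ginv G) (ginv G)"
  using continuous_inv inv_inv by (simp add: homeomorphic_maps_def arrows_def)

lemma openin_inv_image:
  assumes "openin (gtop G) V"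
  shows "openin (gtop G) (ginv G ` V)"
  using assms homeomorphic_maps_inv homeomorphic_imp_open_map homeomorphic_map_maps
  unfolding open_map_def by blast

lemma homeomorphic_maps_inv_subtopology:
  assumes "V \<subseteq> arrows G"
  shows "homeomorphic_maps (subtopology (gtop G) V) (subtopology (gtop G) (ginv G ` V)) (ginv G) (ginv G)"
proof (rule homeomorphic_maps_subtopologies[OF homeomorphic_maps_inv])
  have "ginv G ` V \<subseteq> arrows G"
    using assms inv_closed by auto
  then show "ginv G ` (topspace (gtop G) \<inter> V) = topspace (gtop G) \<inter> ginv G ` V"
    using assms by (simp add: arrows_def inf.absorb2)
qed

lemma star_mem_Cc:
  assumes V: "V \<subseteq> arrows G" and f: "f \<in> Cc G V"
  shows "star G f \<in> Cc G (ginv G ` V)"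
proof -
  have V': "ginv G ` V \<subseteq> arrows G"
    using V inv_closed by auto
  have eq: "star G f = (\<lambda>z. if z \<in> ginv G ` V then cnj (f (ginv G z)) else 0)"
  proof
    fix z
    show "star G f z = (if z \<in> ginv G ` V then cnj (f (ginv G z)) else 0)"
    proof (cases "z \<in> arrows G \<and> ginv G z \<in> V")
      case True
      then have "z \<in> ginv G ` V" using inv_inv by (metis imageI)
      then show ?thesis using True by (simp add: star_def)
    next
      case False
      then have "z \<notin> ginv G ` V" using V inv_inv inv_closed by (metis (no_types, lifting) image_iff subsetD)
      moreover have "star G f z = 0" using False Cc_zero_outside[OF f] by (auto simp: star_def)
      ultimately show ?thesis by simp
    qed
  qed
  have "(\<lambda>x. cnj (f x)) \<in> Cc G V"
    by (rule Cc_comp[OF f]) (simp_all add: continuous_on_cnj)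
  then show ?thesis
    unfolding eq by (rule Cc_transport[OF homeomorphic_maps_inv_subtopology[OF V] _ V V'])
qed

lemma bisection_subset: "bisection G U \<Longrightarrow> U \<subseteq> arrows G"
  by (simp add: bisection_def arrows_def openin_subset)

lemma bisection_inv:
  assumes U: "bisection G U"
  shows "bisection G (ginv G ` U)"
proof -
  have sub: "\<And>x. x \<in> U \<Longrightarrow> x \<in> arrows G"
    using bisection_subset[OF U] by blast
  have "inj_on (gdom G) (ginv G ` U)" "inj_on (gran G) (ginv G ` U)"
    using U sub unfolding bisection_def inj_on_def by (force simp: dom_inv ran_inv)+
  then show ?thesis
    using U openin_inv_image by (simp add: bisection_def)
qed

lemma star_add: "star G (f + g) = star G f + star G g"
  by (auto simp: star_def fun_eq_iff)

lemma star_fscale: "star G (fscale c f) = fscale (cnj c) (star G f)"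
  by (auto simp: star_def fscale_def fun_eq_iff)

lemma star_zero: "star G 0 = 0"
  by (auto simp: star_def fun_eq_iff)

lemma star_mem_A0:
  assumes "f \<in> A0 G"
  shows "star G f \<in> A0 G"
  using assms unfolding A0_def
proof (induction rule: cfun.span_induct_alt)
  case base
  show ?case unfolding star_zero by (rule cfun.span_zero)
next
  case (step c x y)
  then obtain V where V: "openin (gtop G) V" "Hausdorff_space (subtopology (gtop G) V)" "x \<in> Cc G V"
    by blast
  have sub: "V \<subseteq> arrows G" using V(1) openin_subset by (auto simp: arrows_def)
  have "(subtopology (gtop G) V) homeomorphic_space (subtopology (gtop G) (ginv G ` V))"
    using homeomorphic_maps_inv_subtopology[OF sub] homeomorphic_space_def by blast
  then have "star G x \<in> A0 G"
    using star_mem_Cc[OF sub V(3)] Cc_subset_A0[OF openin_inv_image[OF V(1)]] V(2)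
      homeomorphic_Hausdorff_space by blast
  then have "fscale (cnj c) (star G x) + star G y \<in> A0 G"
    using step.IH unfolding A0_def by (intro cfun.span_add cfun.span_scale)
  then show ?case
    by (simp only: star_add star_fscale A0_def)
qed

end

context etale_groupoid
begin

lemma continuous_map_dom: "continuous_map (gtop G) (gtop G) (gdom G)"
  using local_homeomorphism_map_imp_continuous_map[OF local_homeomorphism_dom]
  by (simp add: continuous_map_in_subtopology)

text \<open>
  The domain map fixes the units and is locally injective, so near a unit every arrow must agree with
  its domain.
\<close>

lemma openin_units: "openin (gtop G) (units G)"
proof (subst openin_subopen, intro ballI)
  fix u assume u: "u \<in> units G"
  then have "u \<in> topspace (gtop G)"
    using unit_arrow arrows_def by metis
  then obtain U where U: "openin (gtop G) U" "u \<in> U"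
    "homeomorphic_map (subtopology (gtop G) U)
       (subtopology (subtopology (gtop G) (units G)) (gdom G ` U)) (gdom G)"
    using local_homeomorphism_dom unfolding local_homeomorphism_map_def by blast
  have sub: "U \<subseteq> arrows G"
    using openin_subset[OF U(1)] by (simp add: arrows_def)
  have inj: "inj_on (gdom G) U"
    using U(3) sub by (auto simp: homeomorphic_eq_everything_map arrows_def inf.absorb2)
  let ?W = "{x \<in> topspace (gtop G). gdom G x \<in> U} \<inter> U"
  have "openin (gtop G) ?W"
    using openin_continuous_map_preimage[OF continuous_map_dom U(1)] U(1) by blast
  moreover have "u \<in> ?W"
    using u U(2) \<open>u \<in> topspace (gtop G)\<close> by (simp add: dom_unit)
  \<comment> \<open>\<open>x\<close> and \<open>gdom G x\<close> have the same domain, so they are equal once both lie in \<open>U\<close>\<close>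
  moreover have "?W \<subseteq> units G"
  proof
    fix x assume x: "x \<in> ?W"
    then have "gdom G x = x"
      using inj dom_dom[of x] sub by (auto dest: inj_onD)
    then show "x \<in> units G"
      using x sub dom_mem_units[of x] by auto
  qed
  ultimately show "\<exists>T. openin (gtop G) T \<and> u \<in> T \<and> T \<subseteq> units G" by blast
qed

lemma open_map_dom: "open_map (gtop G) (gtop G) (gdom G)"
  using local_homeomorphism_map_imp_open_map[OF local_homeomorphism_dom] openin_units
  by (simp add: open_map_def openin_open_subtopology)

text \<open>
  The domain map is continuous, open and injective on a bisection.  Through it a bisection inherits the
  separation and compactness properties of the unit space.
\<close>

lemma homeomorphic_maps_dom:
  assumes U: "bisection G U"
  shows "homeomorphic_maps (subtopology (gtop G) U) (subtopology (gtop G) (gdom G ` U))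
    (gdom G) (inv_into U (gdom G))"
proof -
  let ?X = "subtopology (gtop G) U" and ?Y = "subtopology (gtop G) (gdom G ` U)"
  have opn: "openin (gtop G) U" and inj: "inj_on (gdom G) U"
    using U by (auto simp: bisection_def)
  have dU: "openin (gtop G) (gdom G ` U)"
    using open_map_dom opn by (simp add: open_map_def)
  have top: "topspace ?X = U" "topspace ?Y = gdom G ` U"
    using openin_subset[OF opn] openin_subset[OF dU] by auto
  have "homeomorphic_map ?X ?Y (gdom G)"
  proof (rule bijective_open_imp_homeomorphic_map)
    show "continuous_map ?X ?Y (gdom G)"
      using continuous_map_dom by (auto simp: continuous_map_in_subtopology continuous_map_from_subtopology)
    show "open_map ?X ?Y (gdom G)"
      using open_map_dom by (auto simp: open_map_def openin_open_subtopology[OF opn] openin_open_subtopology[OF dU])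
  qed (use top inj in simp_all)
  then obtain g where g: "homeomorphic_maps ?X ?Y (gdom G) g"
    using homeomorphic_map_maps by blast
  have "homeomorphic_maps ?X ?Y (gdom G) (inv_into U (gdom G))"
  proof (rule homeomorphic_maps_eq[OF g])
    fix y assume "y \<in> topspace ?Y"
    then obtain x where "x \<in> U" "y = gdom G x" using top by auto
    then show "g y = inv_into U (gdom G) y"
      using g inj top by (simp add: homeomorphic_maps_def)
  qed simp
  then show ?thesis .
qed

lemma dom_image_subset_units: "U \<subseteq> arrows G \<Longrightarrow> gdom G ` U \<subseteq> units G"
  by (auto simp: dom_mem_units)

lemma bisection_Hausdorff:
  assumes "bisection G U"
  shows "Hausdorff_space (subtopology (gtop G) U)"
proof -
  have "Hausdorff_space (subtopology (subtopology (gtop G) (units G)) (gdom G ` U))"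
    using Hausdorff_units Hausdorff_space_subtopology by blast
  then have "Hausdorff_space (subtopology (gtop G) (gdom G ` U))"
    using dom_image_subset_units[OF bisection_subset[OF assms]]
    by (simp add: subtopology_subtopology inf.absorb2)
  then show ?thesis
    using homeomorphic_maps_dom[OF assms] homeomorphic_Hausdorff_space homeomorphic_space_def by blast
qed

lemma bisection_locally_compact:
  assumes "bisection G U"
  shows "locally_compact_space (subtopology (gtop G) U)"
proof -
  have "openin (subtopology (gtop G) (units G)) (gdom G ` U)"
    using local_homeomorphism_map_imp_open_map[OF local_homeomorphism_dom] assms
    by (simp add: open_map_def bisection_def)
  then have "locally_compact_space (subtopology (subtopology (gtop G) (units G)) (gdom G ` U))"
    using locally_compact_space_open_subset Hausdorff_units locally_compact_units by blast
  then have "locally_compact_space (subtopology (gtop G) (gdom G ` U))"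
    using dom_image_subset_units[OF bisection_subset[OF assms]]
    by (simp add: subtopology_subtopology inf.absorb2)
  then show ?thesis
    using homeomorphic_maps_dom[OF assms] homeomorphic_locally_compact_space homeomorphic_space_def by blast
qed

lemma Cc_bisection_subset_A0: "bisection G U \<Longrightarrow> Cc G U \<subseteq> A0 G"
  using Cc_subset_A0 bisection_Hausdorff by (auto simp: bisection_def)

lemma Cc_units_subset_A0: "Cc G (units G) \<subseteq> A0 G"
  using Cc_subset_A0 openin_units Hausdorff_units by blast

lemma dom_push_mem_Cc:
  assumes U: "bisection G U" and f: "f \<in> Cc G U"
  shows "dom_push G U f \<in> Cc G (units G)"
proof -
  have dU: "gdom G ` U \<subseteq> units G" "openin (gtop G) (gdom G ` U)"
    using dom_image_subset_units bisection_subset[OF U] U open_map_dom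
    by (auto simp: bisection_def open_map_def)
  have "(\<lambda>z. if z \<in> gdom G ` U then f (inv_into U (gdom G) z) else 0) \<in> Cc G (gdom G ` U)"
    using unit_arrow dU by (intro Cc_transport[OF homeomorphic_maps_dom[OF U] f bisection_subset[OF U]]) auto
  then have "dom_push G U f \<in> Cc G (gdom G ` U)"
    by (simp add: dom_push_def[abs_def])
  then show ?thesis
    using Cc_extend_by_zero dU Hausdorff_units by blast
qed

lemma star_units:
  assumes "f \<in> Cc G (units G)"
  shows "star G f = (\<lambda>x. cnj (f x))"
proof
  fix x
  show "star G f x = cnj (f x)"
  proof (cases "x \<in> units G")
    case True
    then show ?thesis by (simp add: star_def unit_arrow inv_unit)
  next
    case False
    have "ginv G x \<notin> units G" if "x \<in> arrows G"
    proof
      assume u: "ginv G x \<in> units G"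
      then have "ginv G x = x"
        using inv_unit[OF u] inv_inv[OF that] by simp
      then show False using u False by simp
    qed
    then show ?thesis
      using False by (simp add: star_def Cc_zero_outside[OF assms])
  qed
qed

end

section \<open>Generators supported in bisections\<close>

text \<open>
  A partition of unity is replaced by an induction over the cover.  The set \<open>U\<close> is split off by a cutoff
  that equals 1 on a neighbourhood of the part \<open>K1\<close> of the support which the other sets miss; what
  remains of \<open>f\<close> is supported in the union of the other sets.
\<close>

lemma Cc_mem_span_of_finite_cover:
  assumes V: "openin (gtop G) V" "Hausdorff_space (subtopology (gtop G) V)"
      "completely_regular_space (subtopology (gtop G) V)"
    and "finite \<U>" and "\<And>U. U \<in> \<U> \<Longrightarrow> openin (gtop G) U"
    and "f \<in> Cc G V" and "compactin (gtop G) K" "K \<subseteq> V" "\<And>x. f x \<noteq> 0 \<Longrightarrow> x \<in> K"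
    and "K \<subseteq> \<Union>\<U>"
  shows "f \<in> cfun.span (\<Union>U\<in>\<U>. Cc G (U \<inter> V))"
  using assms(4-)
proof (induction \<U> arbitrary: f K rule: finite_induct)
  case empty
  then have "f x = 0" for x by auto
  then have "f = 0" by (auto simp: fun_eq_iff)
  then show ?case using cfun.span_zero by blast
next
  case (insert U \<U>)
  let ?X = "subtopology (gtop G) V"
  let ?S = "\<Union>U\<in>\<U>. Cc G (U \<inter> V)"
  have cK: "compactin ?X K"
    using insert.prems(3,4) by (simp add: compactin_subtopology)
  have open_X: "openin ?X (W \<inter> V)" if "openin (gtop G) W" for W
    using that by (auto simp: openin_subtopology)
  have "openin (gtop G) (\<Union>\<U>)"
    using insert.prems(1) by (intro openin_Union) blast
  then have "closedin ?X (topspace ?X - \<Union>\<U> \<inter> V)"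
    using open_X by blast
  then have "closedin ?X (K \<inter> (topspace ?X - \<Union>\<U> \<inter> V))"
    using compactin_imp_closedin[OF V(2) cK] by blast
  then have K1: "compactin ?X (K \<inter> (topspace ?X - \<Union>\<U> \<inter> V))" (is "compactin ?X ?K1")
    by (rule closed_compactin[OF cK, rotated]) blast
  have oU: "openin (gtop G) U" using insert.prems(1) by blast
  then have "closedin ?X (topspace ?X - U \<inter> V)"
    using open_X by blast
  moreover have "disjnt ?K1 (topspace ?X - U \<inter> V)"
    using insert.prems(6) by (auto simp: disjnt_def)
  \<comment> \<open>the value 3 is arbitrary above 2: the cutoff below vanishes for \<open>\<phi> \<le> 1\<close> and is 1 for \<open>\<phi> \<ge> 2\<close>,
    so the remainder lives on \<open>{\<phi> \<le> 2}\<close>, a closed set disjoint from \<open>K1\<close>\<close>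
  ultimately obtain \<phi> :: "'a \<Rightarrow> real" where \<phi>: "continuous_map ?X euclideanreal \<phi>"
    "\<phi> ` ?K1 \<subseteq> {3}" "\<phi> ` (topspace ?X - U \<inter> V) \<subseteq> {0}"
    by (rule Urysohn_completely_regular_compact_closed_alt[OF V(3) K1])
  let ?\<psi> = "\<lambda>x. complex_of_real (min 1 (max 0 (\<phi> x - 1)))"
  define f1 where "f1 = (\<lambda>x. ?\<psi> x * f x)"
  define f2 where "f2 = (\<lambda>x. (1 - ?\<psi> x) * f x)"
  have "f1 \<in> Cc G (U \<inter> V)"
    unfolding f1_def
  proof (rule Cc_cutoff[OF V(1,2) _ _ insert.prems(2-5) \<phi>(1)])
    fix x assume "x \<in> K" "x \<notin> U \<inter> V"
    then have "x \<in> topspace ?X - U \<inter> V"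
      using compactin_subset_topspace[OF cK] by blast
    then show "\<phi> x = 0" using \<phi>(3) by blast
  qed (use oU V(1) in auto)
  then have f1: "f1 \<in> cfun.span (\<Union>U\<in>insert U \<U>. Cc G (U \<inter> V))"
    by (intro cfun.span_base) blast
  have "continuous_map ?X euclidean (\<lambda>x. 1 - ?\<psi> x)"
    by (rule continuous_map_comp_UNIV[OF \<phi>(1)]) (intro continuous_intros)
  then have "continuous_map ?X euclidean f2"
    unfolding f2_def using Cc_continuous[OF insert.prems(2)]
    by (simp add: continuous_map_atin tendsto_mult)
  then have f2: "f2 \<in> Cc G V"
    by (rule Cc_of_support_subset[OF insert.prems(2)]) (auto simp: f2_def)
  let ?K2 = "K \<inter> {x \<in> topspace ?X. \<phi> x \<in> {..2}}"
  have "closedin ?X {x \<in> topspace ?X. \<phi> x \<in> {..2}}"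
    using \<phi>(1) by (rule closedin_continuous_map_preimage) auto
  then have "closedin ?X ?K2"
    using compactin_imp_closedin[OF V(2) cK] by blast
  then have K2: "compactin ?X ?K2"
    by (rule closed_compactin[OF cK, rotated]) blast
  have "f2 \<in> cfun.span ?S"
  proof (rule insert.IH[OF _ f2])
    show "compactin (gtop G) ?K2" "?K2 \<subseteq> V"
      using K2 by (simp_all add: compactin_subtopology)
    show "x \<in> ?K2" if "f2 x \<noteq> 0" for x
    proof -
      have "x \<in> K" using that insert.prems(5)[of x] by (simp add: f2_def)
      moreover have "\<phi> x \<le> 2" using that by (simp add: f2_def max_def min_def split: if_splits)
      ultimately show ?thesis using compactin_subset_topspace[OF cK] by auto
    qed
    show "?K2 \<subseteq> \<Union>\<U>"
    proof
      fix x assume x: "x \<in> ?K2"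
      show "x \<in> \<Union>\<U>"
      proof (rule ccontr)
        assume "x \<notin> \<Union>\<U>"
        then have "x \<in> ?K1" using x by blast
        then have "\<phi> x = 3" using \<phi>(2) by blast
        then show False using x by simp
      qed
    qed
  qed (use insert.prems(1) in blast)
  moreover have "cfun.span ?S \<subseteq> cfun.span (\<Union>U\<in>insert U \<U>. Cc G (U \<inter> V))"
    by (intro cfun.span_mono) blast
  moreover have "f = f1 + f2"
    by (auto simp: f1_def f2_def fun_eq_iff algebra_simps)
  ultimately show ?case
    using f1 cfun.span_add by blast
qed

context etale_groupoid
begin

text \<open>
  The open sets that carry the generators need not lie in a single bisection.  Local compactness,
  together with the Hausdorff property, is what provides Urysohn functions on them.
\<close>

lemma locally_compact_of_bisection_cover:
  assumes V: "openin (gtop G) V" and cover: "\<And>x. x \<in> V \<Longrightarrow> \<exists>U. bisection G U \<and> x \<in> U"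
  shows "locally_compact_space (subtopology (gtop G) V)"
  unfolding locally_compact_space_def
proof
  fix x assume "x \<in> topspace (subtopology (gtop G) V)"
  then have x: "x \<in> V" "x \<in> topspace (gtop G)" by auto
  then obtain U where U: "bisection G U" "x \<in> U" using cover by blast
  have UV: "bisection G (U \<inter> V)"
    using U(1) V by (auto simp: bisection_def intro: inj_on_subset)
  then have opn: "openin (gtop G) (U \<inter> V)" by (simp add: bisection_def)
  have "x \<in> topspace (subtopology (gtop G) (U \<inter> V))"
    using x U(2) by simp
  then obtain W K where WK: "openin (subtopology (gtop G) (U \<inter> V)) W"
    "compactin (subtopology (gtop G) (U \<inter> V)) K" "x \<in> W" "W \<subseteq> K"
    using bisection_locally_compact[OF UV] unfolding locally_compact_space_def by blast
  have "openin (subtopology (gtop G) V) W"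
    using WK(1) by (simp add: openin_open_subtopology[OF opn] openin_open_subtopology[OF V])
  moreover have "compactin (subtopology (gtop G) V) K"
    using WK(2) by (simp add: compactin_subtopology)
  ultimately show "\<exists>W K. openin (subtopology (gtop G) V) W \<and> compactin (subtopology (gtop G) V) K
      \<and> x \<in> W \<and> W \<subseteq> K"
    using WK(3,4) by blast
qed

text \<open>
  The support of a generator is compact, so finitely many members of the cover suffice for it.
\<close>

lemma A0_subset_span_bisections:
  assumes bis: "\<And>U. U \<in> \<F> \<Longrightarrow> bisection G U" and cover: "\<Union>\<F> = arrows G"
  shows "A0 G \<subseteq> cfun.span (\<Union>U\<in>\<F>. Cc G U)"
  unfolding A0_def
proof (rule cfun.span_minimal)
  show "cfun.subspace (cfun.span (\<Union>U\<in>\<F>. Cc G U))"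
    by (rule cfun.subspace_span)
next
  have "f \<in> cfun.span (\<Union>U\<in>\<F>. Cc G U)"
    if V: "openin (gtop G) V" "Hausdorff_space (subtopology (gtop G) V)" and f: "f \<in> Cc G V" for V f
  proof -
    have sub: "V \<subseteq> arrows G"
      using openin_subset[OF V(1)] by (simp add: arrows_def)
    obtain K where K: "compactin (gtop G) K" "K \<subseteq> V" "\<And>x. f x \<noteq> 0 \<Longrightarrow> x \<in> K"
      using Cc_compact_support[OF f sub] by blast
    have "\<exists>\<U>. finite \<U> \<and> \<U> \<subseteq> \<F> \<and> K \<subseteq> \<Union>\<U>"
      using K(1,2) bis cover sub by (intro compactinD) (auto simp: bisection_def)
    then obtain \<U> where \<U>: "finite \<U>" "\<U> \<subseteq> \<F>" "K \<subseteq> \<Union>\<U>" by blast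
    have "locally_compact_space (subtopology (gtop G) V)"
      using bis cover sub by (intro locally_compact_of_bisection_cover V(1)) blast
    then have reg: "completely_regular_space (subtopology (gtop G) V)"
      using V(2) locally_compact_regular_imp_completely_regular_space by blast
    have opn: "openin (gtop G) U" if "U \<in> \<F>" for U
      using bis[OF that] by (simp add: bisection_def)
    have "f \<in> cfun.span (\<Union>U\<in>\<U>. Cc G (U \<inter> V))"
      using \<U> opn by (intro Cc_mem_span_of_finite_cover[OF V reg \<U>(1) _ f K]) auto
    moreover have "(\<Union>U\<in>\<U>. Cc G (U \<inter> V)) \<subseteq> (\<Union>U\<in>\<F>. Cc G U)"
    proof
      fix g assume "g \<in> (\<Union>U\<in>\<U>. Cc G (U \<inter> V))"
      then obtain U where U: "U \<in> \<F>" "g \<in> Cc G (U \<inter> V)" using \<U>(2) by blast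
      have "g \<in> Cc G U"
        using U opn V(1) by (intro Cc_extend_by_zero[OF U(2)] bisection_Hausdorff bis) auto
      then show "g \<in> (\<Union>U\<in>\<F>. Cc G U)" using U(1) by blast
    qed
    ultimately show ?thesis
      using cfun.span_mono by blast
  qed
  then show "(\<Union>V \<in> {V. openin (gtop G) V \<and> Hausdorff_space (subtopology (gtop G) V)}. Cc G V)
      \<subseteq> cfun.span (\<Union>U\<in>\<F>. Cc G U)"
    by blast
qed

end

section \<open>Contractivity of *-representations\<close>

lemma algebra_homD:
  assumes "algebra_hom G H \<pi>" "f \<in> A0 G"
  shows "\<pi> f \<in> bounded_operators H"
    and "g \<in> A0 G \<Longrightarrow> \<xi> \<in> carrier H \<Longrightarrow> \<pi> (f + g) \<xi> = \<pi> f \<xi> \<oplus>\<^bsub>H\<^esub> \<pi> g \<xi>"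
    and "\<xi> \<in> carrier H \<Longrightarrow> \<pi> (fscale c f) \<xi> = c \<odot>\<^bsub>H\<^esub> \<pi> f \<xi>"
    and "g \<in> A0 G \<Longrightarrow> \<xi> \<in> carrier H \<Longrightarrow> \<pi> (conv G f g) \<xi> = \<pi> f (\<pi> g \<xi>)"
  using assms unfolding algebra_hom_def by blast+

context etale_groupoid
begin

text \<open>
  Choosing \<open>k\<close> as the smaller root of \<open>(M - k)\<^sup>2 = M\<^sup>2 - \<bar>f\<bar>\<^sup>2\<close> makes it vanish wherever \<open>f\<close> does, so that
  it has compact support.  The algebra only sees the resulting relation \<open>g + k * k = 2 M k\<close>, in which the
  constant function 1 no longer occurs; this matters because the unit space may fail to be compact.
\<close>

lemma star_representation_contractive:
  assumes H: "hilbert_space H" and rep: "star_representation G H \<pi>"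
    and U: "bisection G U" and f: "f \<in> Cc G U"
  shows "opnorm H (\<pi> f) \<le> sup_norm f"
proof -
  interpret hilbert_space H by (rule H)
  have hom: "algebra_hom G H \<pi>" and adj: "\<And>f. f \<in> A0 G \<Longrightarrow> is_adjoint H (\<pi> f) (\<pi> (star G f))"
    using rep by (auto simp: star_representation_def)
  note sub = bisection_subset[OF U]
  define M where "M = sup_norm f"
  have le: "cmod (f x) \<le> M" for x
    unfolding M_def by (rule Cc_le_sup_norm[OF f sub])
  have M: "0 \<le> M" using order_trans[OF norm_ge_zero le] .
  define g where "g = dom_push G U (\<lambda>x. complex_of_real ((cmod (f x))\<^sup>2))"
  define k where "k = dom_push G U (\<lambda>x. complex_of_real (M - sqrt (M\<^sup>2 - (cmod (f x))\<^sup>2)))"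
  have k: "k \<in> Cc G (units G)"
    unfolding k_def using M
    by (intro dom_push_mem_Cc[OF U] Cc_comp[OF f, of "\<lambda>w. complex_of_real (M - sqrt (M\<^sup>2 - (cmod w)\<^sup>2))"])
      (auto intro!: continuous_intros)
  have g: "g \<in> Cc G (units G)"
    unfolding g_def
    by (intro dom_push_mem_Cc[OF U] Cc_comp[OF f, of "\<lambda>w. complex_of_real ((cmod w)\<^sup>2)"])
      (auto intro!: continuous_intros)
  have k_zero: "k z = 0" if "z \<notin> units G" for z
    using Cc_zero_outside[OF k that] .
  have kk_eq: "conv G k k = (\<lambda>z. (k z)\<^sup>2)"
  proof
    fix z
    have "conv G k k z = k (gran G z) * k z"
      using k_zero unit_arrow by (intro conv_units_left) blast+
    then show "conv G k k z = (k z)\<^sup>2"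
      using k_zero[of z] ran_unit[of z] by (cases "z \<in> units G") (auto simp: power2_eq_square)
  qed
  have kk: "conv G k k \<in> Cc G (units G)"
    unfolding kk_eq by (rule Cc_comp[OF k]) (auto intro!: continuous_intros)
  have star_k: "star G k = k"
    unfolding star_units[OF k] by (auto simp: k_def dom_push_def)
  have conv_f: "conv G (star G f) f = g"
    unfolding g_def using U sub Cc_zero_outside[OF f]
    by (intro conv_star_self) (auto simp: bisection_def)
  have gkk: "g + conv G k k = fscale (complex_of_real (2 * M)) k"
  proof
    fix z
    have alg: "a\<^sup>2 + (M - sqrt (M\<^sup>2 - a\<^sup>2))\<^sup>2 = 2 * M * (M - sqrt (M\<^sup>2 - a\<^sup>2))"
      if "0 \<le> a" "a \<le> M" for a :: real
    proof -
      have "(sqrt (M\<^sup>2 - a\<^sup>2))\<^sup>2 = M\<^sup>2 - a\<^sup>2"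
        using that by (simp add: power_mono)
      then show ?thesis by (simp add: power2_eq_square algebra_simps)
    qed
    show "(g + conv G k k) z = fscale (complex_of_real (2 * M)) k z"
    proof (cases "z \<in> gdom G ` U")
      case True
      have "complex_of_real ((cmod (f w))\<^sup>2 + (M - sqrt (M\<^sup>2 - (cmod (f w))\<^sup>2))\<^sup>2)
          = complex_of_real (2 * M * (M - sqrt (M\<^sup>2 - (cmod (f w))\<^sup>2)))" for w
        using alg[of "cmod (f w)"] le[of w] by (simp only: norm_ge_zero)
      from this[of "inv_into U (gdom G) z"] show ?thesis
        unfolding plus_fun_apply kk_eq using True by (simp add: fscale_def g_def k_def dom_push_def)
    next
      case False
      then show ?thesis
        unfolding plus_fun_apply kk_eq by (simp add: fscale_def g_def k_def dom_push_def)
    qed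
  qed
  have A0: "f \<in> A0 G" "star G f \<in> A0 G" "g \<in> A0 G" "k \<in> A0 G" "conv G k k \<in> A0 G"
    using f g k kk Cc_bisection_subset_A0[OF U] Cc_units_subset_A0 star_mem_A0 by blast+
  have "hnorm H (\<pi> f \<xi>) \<le> M * hnorm H \<xi>" if \<xi>: "\<xi> \<in> carrier H" for \<xi>
  proof (rule hnorm_le_of_inner_identity[OF \<xi> _ _ M, where k = "\<pi> k \<xi>"])
    have closed: "\<pi> h \<xi> \<in> carrier H" if "h \<in> A0 G" for h
      using bounded_operators_closed[OF algebra_homD(1)[OF hom that] \<xi>] .
    then show fx: "\<pi> f \<xi> \<in> carrier H" and kx: "\<pi> k \<xi> \<in> carrier H"
      using A0 by blast+
    have "hinner H (\<pi> f \<xi>) (\<pi> f \<xi>) = hinner H \<xi> (\<pi> g \<xi>)"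
      using adj[OF A0(1)] \<xi> fx algebra_homD(4)[OF hom A0(2) A0(1) \<xi>] conv_f
      by (simp add: is_adjoint_def)
    moreover have "hinner H (\<pi> k \<xi>) (\<pi> k \<xi>) = hinner H \<xi> (\<pi> (conv G k k) \<xi>)"
      using adj[OF A0(4)] \<xi> kx algebra_homD(4)[OF hom A0(4) A0(4) \<xi>] star_k
      by (simp add: is_adjoint_def)
    ultimately have "hinner H (\<pi> f \<xi>) (\<pi> f \<xi>) + hinner H (\<pi> k \<xi>) (\<pi> k \<xi>)
        = hinner H \<xi> (\<pi> (g + conv G k k) \<xi>)"
      using inner_add_right[OF \<xi> closed[OF A0(3)] closed[OF A0(5)]]
        algebra_homD(2)[OF hom A0(3) A0(5) \<xi>] by simp
    also have "\<dots> = complex_of_real (2 * M) * hinner H \<xi> (\<pi> k \<xi>)"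
      unfolding gkk algebra_homD(3)[OF hom A0(4) \<xi>] inner_scale_right[OF \<xi> kx] by simp
    finally have "Re (hinner H (\<pi> f \<xi>) (\<pi> f \<xi>) + hinner H (\<pi> k \<xi>) (\<pi> k \<xi>))
        = Re (complex_of_real (2 * M) * hinner H \<xi> (\<pi> k \<xi>))"
      by (rule arg_cong)
    then show "Re (hinner H (\<pi> f \<xi>) (\<pi> f \<xi>)) + Re (hinner H (\<pi> k \<xi>) (\<pi> k \<xi>))
        = 2 * M * Re (hinner H \<xi> (\<pi> k \<xi>))"
      by simp
  qed
  then show ?thesis
    using opnorm_le[OF M, of "\<pi> f"] by (simp add: M_def)
qed

lemma star_representation_imp_representation:
  assumes "hilbert_space H" "star_representation G H \<pi>"
  shows "representation G H \<pi>"
  unfolding representation_def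
proof (intro conjI allI impI ballI)
  show "algebra_hom G H \<pi>"
    using assms(2) by (simp add: star_representation_def)
  show "opnorm H (\<pi> f) \<le> sup_norm f" if "bisection G U" "f \<in> Cc G U" for U f
    using star_representation_contractive[OF assms that] .
  show "is_adjoint H (\<pi> f) (\<pi> (\<lambda>x. cnj (f x)))" if "f \<in> Cc G (units G)" for f
  proof -
    have "is_adjoint H (\<pi> f) (\<pi> (star G f))"
      using assms(2) Cc_units_subset_A0 that unfolding star_representation_def by blast
    then show ?thesis by (simp only: star_units[OF that])
  qed
qed

section \<open>Adjoints in a representation\<close>

lemma star_indicator: "U \<subseteq> arrows G \<Longrightarrow> star G (indicator U) = indicator (ginv G ` U)"
proof
  fix x assume U: "U \<subseteq> arrows G"
  have "x \<in> ginv G ` U \<longleftrightarrow> x \<in> arrows G \<and> ginv G x \<in> U"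
  proof
    assume "x \<in> ginv G ` U"
    then show "x \<in> arrows G \<and> ginv G x \<in> U"
      using U inv_closed by (auto simp: inv_inv subset_iff)
  next
    assume "x \<in> arrows G \<and> ginv G x \<in> U"
    then show "x \<in> ginv G ` U"
      using inv_inv[of x] imageI[of "ginv G x" U "ginv G"] by simp
  qed
  then show "star G (indicator U) x = indicator (ginv G ` U) x"
    by (auto simp: star_def indicator_def)
qed

lemma dom_push_indicator: "dom_push G U (indicator U) = indicator (gdom G ` U)"
  by (auto simp: dom_push_def fun_eq_iff indicator_def inv_into_into)

lemma conv_indicator_inv:
  assumes U: "bisection G U"
  shows "conv G (indicator (ginv G ` U)) (indicator U) = indicator (gdom G ` U)"
proof -
  have "(\<lambda>x. complex_of_real ((cmod (indicator U x))\<^sup>2)) = indicator U"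
    by (auto simp: indicator_def)
  then have "conv G (star G (indicator U)) (indicator U) = dom_push G U (indicator U)"
    using U bisection_subset[OF U] by (subst conv_star_self) (auto simp: bisection_def)
  then show ?thesis
    by (simp add: star_indicator[OF bisection_subset[OF U]] dom_push_indicator)
qed

lemma conv_indicator_dom_push:
  assumes U: "bisection G U" and f: "f \<in> Cc G U"
  shows "conv G (indicator U) (dom_push G U f) = f"
proof
  fix z
  have inj: "inj_on (gdom G) U" and sub: "U \<subseteq> arrows G"
    using U bisection_subset by (auto simp: bisection_def)
  have "conv G (indicator U) (dom_push G U f) z = indicator U z * dom_push G U f (gdom G z)"
    using sub Cc_zero_outside[OF dom_push_mem_Cc[OF U f]]
    by (intro conv_units_right) (auto simp: indicator_def)
  also have "\<dots> = f z"
    using inj Cc_zero_outside[OF f, of z] by (cases "z \<in> U") (simp_all add: dom_push_def)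
  finally show "conv G (indicator U) (dom_push G U f) z = f z" .
qed

lemma conv_cnj_dom_push_indicator:
  assumes U: "bisection G U" and f: "f \<in> Cc G U"
  shows "conv G (\<lambda>x. cnj (dom_push G U f x)) (indicator (ginv G ` U)) = star G f"
proof
  fix z
  have inj: "inj_on (gdom G) U" and sub: "U \<subseteq> arrows G"
    using U bisection_subset by (auto simp: bisection_def)
  have V: "ginv G ` U \<subseteq> arrows G" using bisection_subset[OF bisection_inv[OF U]] .
  have "conv G (\<lambda>x. cnj (dom_push G U f x)) (indicator (ginv G ` U)) z
      = cnj (dom_push G U f (gran G z)) * indicator (ginv G ` U) z"
    using V Cc_zero_outside[OF dom_push_mem_Cc[OF U f]]
    by (intro conv_units_left) (auto simp: indicator_def)
  also have "\<dots> = star G f z"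
  proof (cases "z \<in> ginv G ` U")
    case True
    then obtain w where w: "w \<in> U" "z = ginv G w" by blast
    then have "w \<in> arrows G" using sub by blast
    then show ?thesis
      using w inj by (simp add: star_def dom_push_def ran_inv inv_inv inv_closed)
  next
    case False
    then show ?thesis
      using Cc_zero_outside[OF star_mem_Cc[OF sub f] False] by simp
  qed
  finally show "conv G (\<lambda>x. cnj (dom_push G U f x)) (indicator (ginv G ` U)) z = star G f z" .
qed

lemma conv_ran_indicator:
  assumes U: "bisection G U"
  shows "conv G (indicator (gdom G ` ginv G ` U)) (indicator U) = indicator U"
proof
  fix z
  have sub: "U \<subseteq> arrows G" using bisection_subset[OF U] .
  have "gdom G ` ginv G ` U \<subseteq> units G"
    using bisection_subset[OF bisection_inv[OF U]] by (rule dom_image_subset_units)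
  then have "conv G (indicator (gdom G ` ginv G ` U)) (indicator U) z
      = indicator (gdom G ` ginv G ` U) (gran G z) * indicator U z"
    using sub by (intro conv_units_left) (auto simp: indicator_def)
  also have "\<dots> = indicator U z"
  proof (cases "z \<in> U")
    case True
    then have "gran G z = gdom G (ginv G z)" using sub dom_inv by auto
    then show ?thesis using True by simp
  qed simp
  finally show "conv G (indicator (gdom G ` ginv G ` U)) (indicator U) z = (indicator U z :: complex)" .
qed

text \<open>
  The set \<open>gdom G ` ginv G ` U\<close> is the set of ranges of the arrows in \<open>U\<close>.  Written in this way, each
  identity between indicator functions holds for \<open>U\<close> and for its inverse alike.
\<close>

lemma representation_indicator_adjoint:
  assumes H: "hilbert_space H" and rep: "representation G H \<pi>"
    and U: "bisection G U" "compactin (gtop G) U"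
  shows "is_adjoint H (\<pi> (indicator U)) (\<pi> (indicator (ginv G ` U)))"
proof -
  interpret hilbert_space H by (rule H)
  have hom: "algebra_hom G H \<pi>"
    and contr: "\<And>U f. bisection G U \<Longrightarrow> f \<in> Cc G U \<Longrightarrow> opnorm H (\<pi> f) \<le> sup_norm f"
    and adj: "\<And>f. f \<in> Cc G (units G) \<Longrightarrow> is_adjoint H (\<pi> f) (\<pi> (\<lambda>x. cnj (f x)))"
    using rep by (auto simp: representation_def)
  let ?V = "ginv G ` U"
  have V: "bisection G ?V" "compactin (gtop G) ?V"
    using bisection_inv[OF U(1)] image_compactin[OF U(2) continuous_inv] by auto
  have VV: "ginv G ` ?V = U"
    using inv_image_inv bisection_subset[OF U(1)] by blast
  have Cc: "indicator W \<in> Cc G W" "indicator W \<in> A0 G"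
      "indicator (gdom G ` W) \<in> Cc G (units G)" "indicator (gdom G ` W) \<in> A0 G"
    if W: "bisection G W" "compactin (gtop G) W" for W
  proof -
    show 1: "indicator W \<in> Cc G W" by (rule indicator_mem_Cc[OF W(2)])
    then show "indicator W \<in> A0 G" using Cc_bisection_subset_A0[OF W(1)] by blast
    show "indicator (gdom G ` W) \<in> Cc G (units G)"
      using dom_push_mem_Cc[OF W(1) 1] by (simp add: dom_push_indicator)
    then show "indicator (gdom G ` W) \<in> A0 G" using Cc_units_subset_A0 by blast
  qed
  have norm: "hnorm H (\<pi> (indicator W) \<xi>) \<le> hnorm H \<xi>"
    if W: "bisection G W" "compactin (gtop G) W" and \<xi>: "\<xi> \<in> carrier H" for W \<xi>
  proof -
    have "opnorm H (\<pi> (indicator W)) \<le> 1"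
      using contr[OF W(1) Cc(1)[OF W]] sup_norm_indicator_le_1 by (rule order_trans)
    then have "opnorm H (\<pi> (indicator W)) * hnorm H \<xi> \<le> 1 * hnorm H \<xi>"
      using hnorm_nonneg[OF \<xi>] by (rule mult_right_mono)
    then show ?thesis
      using hnorm_le_opnorm[OF algebra_homD(1)[OF hom Cc(2)[OF W]] \<xi>] by simp
  qed
  have self_adj: "is_adjoint H (\<pi> (indicator (gdom G ` W))) (\<pi> (indicator (gdom G ` W)))"
    if W: "bisection G W" "compactin (gtop G) W" for W
  proof -
    have "(\<lambda>x. cnj (indicator (gdom G ` W) x)) = indicator (gdom G ` W)"
      by (auto simp: indicator_def)
    then show ?thesis using adj[OF Cc(3)[OF W]] by simp
  qed
  note mult = algebra_homD(4)[OF hom, symmetric]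
  show ?thesis
  proof (rule adjoint_of_mutually_inverse_contractions[where P = "\<pi> (indicator (gdom G ` U))"
        and Q = "\<pi> (indicator (gdom G ` ?V))"])
    fix \<xi> assume \<xi>: "\<xi> \<in> carrier H"
    show "\<pi> (indicator ?V) (\<pi> (indicator U) \<xi>) = \<pi> (indicator (gdom G ` U)) \<xi>"
      using mult[OF Cc(2)[OF V] Cc(2)[OF U] \<xi>] conv_indicator_inv[OF U(1)] by simp
    show "\<pi> (indicator U) (\<pi> (indicator ?V) \<xi>) = \<pi> (indicator (gdom G ` ?V)) \<xi>"
      using mult[OF Cc(2)[OF U] Cc(2)[OF V] \<xi>] conv_indicator_inv[OF V(1)] VV by simp
    show "\<pi> (indicator U) (\<pi> (indicator (gdom G ` U)) \<xi>) = \<pi> (indicator U) \<xi>"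
      using mult[OF Cc(2)[OF U] Cc(4)[OF U] \<xi>] conv_indicator_dom_push[OF U(1) Cc(1)[OF U]]
      by (simp add: dom_push_indicator)
    show "\<pi> (indicator (gdom G ` ?V)) (\<pi> (indicator U) \<xi>) = \<pi> (indicator U) \<xi>"
      using mult[OF Cc(4)[OF V] Cc(2)[OF U] \<xi>] conv_ran_indicator[OF U(1)] by simp
    show "\<pi> (indicator (gdom G ` U)) (\<pi> (indicator ?V) \<xi>) = \<pi> (indicator ?V) \<xi>"
      using mult[OF Cc(4)[OF U] Cc(2)[OF V] \<xi>] conv_ran_indicator[OF V(1)] VV by simp
  qed (use norm U V self_adj algebra_homD(1)[OF hom] Cc(2,4) in blast)+
qed

text \<open>
  The factorization \<open>f = 1\<^sub>U * h\<close> through the units, with \<open>h = dom_push G U f\<close>, reduces the claim to the two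
  known adjoints: that of \<open>1\<^sub>U\<close>, and that of a function on the units, which is part of being a
  representation.  Compactness of \<open>U\<close> is needed for \<open>1\<^sub>U\<close> to belong to the algebra.
\<close>

lemma representation_adjoint_compact_bisection:
  assumes H: "hilbert_space H" and rep: "representation G H \<pi>"
    and U: "bisection G U" "compactin (gtop G) U" and f: "f \<in> Cc G U"
  shows "is_adjoint H (\<pi> f) (\<pi> (star G f))"
  unfolding is_adjoint_def
proof (intro ballI)
  fix \<xi> \<eta> assume \<xi>: "\<xi> \<in> carrier H" and \<eta>: "\<eta> \<in> carrier H"
  interpret hilbert_space H by (rule H)
  have hom: "algebra_hom G H \<pi>"
    using rep by (simp add: representation_def)
  define h where "h = dom_push G U f"
  have h: "h \<in> Cc G (units G)" "(\<lambda>x. cnj (h x)) \<in> Cc G (units G)"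
    using dom_push_mem_Cc[OF U(1) f] Cc_comp[OF dom_push_mem_Cc[OF U(1) f], of cnj]
    by (simp_all add: h_def continuous_on_cnj)
  have V: "bisection G (ginv G ` U)" "compactin (gtop G) (ginv G ` U)"
    using bisection_inv[OF U(1)] image_compactin[OF U(2) continuous_inv] by auto
  have A0: "h \<in> A0 G" "(\<lambda>x. cnj (h x)) \<in> A0 G" "indicator U \<in> A0 G" "indicator (ginv G ` U) \<in> A0 G"
    using h Cc_units_subset_A0 Cc_bisection_subset_A0 U V indicator_mem_Cc by blast+
  note closed = bounded_operators_closed[OF algebra_homD(1)[OF hom]]
  have "hinner H (\<pi> f \<xi>) \<eta> = hinner H (\<pi> (indicator U) (\<pi> h \<xi>)) \<eta>"
    using algebra_homD(4)[OF hom A0(3) A0(1) \<xi>] conv_indicator_dom_push[OF U(1) f] by (simp add: h_def)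
  also have "\<dots> = hinner H (\<pi> h \<xi>) (\<pi> (indicator (ginv G ` U)) \<eta>)"
    using representation_indicator_adjoint[OF H rep U] closed[OF A0(1) \<xi>] \<eta>
    by (simp add: is_adjoint_def)
  also have "\<dots> = hinner H \<xi> (\<pi> (\<lambda>x. cnj (h x)) (\<pi> (indicator (ginv G ` U)) \<eta>))"
    using rep h(1) \<xi> closed[OF A0(4) \<eta>] by (simp add: representation_def is_adjoint_def)
  also have "\<dots> = hinner H \<xi> (\<pi> (star G f) \<eta>)"
    using algebra_homD(4)[OF hom A0(2) A0(4) \<eta>] conv_cnj_dom_push_indicator[OF U(1) f]
    by (simp add: h_def)
  finally show "hinner H (\<pi> f \<xi>) \<eta> = hinner H \<xi> (\<pi> (star G f) \<eta>)" .
qed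

lemma representation_imp_star_representation:
  assumes H: "hilbert_space H" and rep: "representation G H \<pi>"
    and \<F>: "\<And>U. U \<in> \<F> \<Longrightarrow> bisection G U \<and> compactin (gtop G) U" "\<Union>\<F> = arrows G"
  shows "star_representation G H \<pi>"
proof -
  interpret hilbert_space H by (rule H)
  have hom: "algebra_hom G H \<pi>"
    using rep by (simp add: representation_def)
  note closed = bounded_operators_closed[OF algebra_homD(1)[OF hom]]
  have "f \<in> A0 G \<and> is_adjoint H (\<pi> f) (\<pi> (star G f))"
    if "f \<in> cfun.span (\<Union>U\<in>\<F>. Cc G U)" for f
    using that
  proof (induction rule: cfun.span_induct_alt)
    case base
    have 0: "(0 :: 'a \<Rightarrow> complex) \<in> A0 G"
      unfolding A0_def by (rule cfun.span_zero)
    have "\<pi> 0 \<xi> = 0 \<odot>\<^bsub>H\<^esub> \<pi> 0 \<xi>" if "\<xi> \<in> carrier H" for \<xi>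
      using algebra_homD(3)[OF hom 0 that, of 0] by (simp only: cfun.scale_zero_left)
    then have "hinner H (\<pi> 0 \<xi>) \<eta> = 0" "hinner H \<eta> (\<pi> 0 \<xi>) = 0"
      if "\<xi> \<in> carrier H" "\<eta> \<in> carrier H" for \<xi> \<eta>
      using inner_scale_left[OF closed[OF 0 that(1)] that(2), of 0]
        inner_scale_right[OF that(2) closed[OF 0 that(1)], of 0] that(1) by simp_all
    then show ?case
      unfolding star_zero is_adjoint_def using 0 by metis
  next
    case (step c f g)
    then obtain U where U: "U \<in> \<F>" "f \<in> Cc G U" by blast
    have bis: "bisection G U" "compactin (gtop G) U" using \<F>(1)[OF U(1)] by auto
    have adj_f: "is_adjoint H (\<pi> f) (\<pi> (star G f))"
      by (rule representation_adjoint_compact_bisection[OF H rep bis U(2)])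
    have adj_g: "is_adjoint H (\<pi> g) (\<pi> (star G g))" and g: "g \<in> A0 G"
      using step.IH by auto
    have f: "f \<in> A0 G" using Cc_bisection_subset_A0[OF bis(1)] U(2) by blast
    have scale: "fscale a h \<in> A0 G" if "h \<in> A0 G" for a h
      using that unfolding A0_def by (rule cfun.span_scale)
    note star = star_mem_A0[OF f] star_mem_A0[OF g]
    have "fscale c f + g \<in> A0 G"
      using scale[OF f] g unfolding A0_def by (rule cfun.span_add)
    moreover have "is_adjoint H (\<pi> (fscale c f + g)) (\<pi> (star G (fscale c f + g)))"
      unfolding is_adjoint_def
    proof (intro ballI)
      fix \<xi> \<eta> assume \<xi>: "\<xi> \<in> carrier H" and \<eta>: "\<eta> \<in> carrier H"
      have "hinner H (\<pi> (fscale c f + g) \<xi>) \<eta> = c * hinner H (\<pi> f \<xi>) \<eta> + hinner H (\<pi> g \<xi>) \<eta>"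
        unfolding algebra_homD(2)[OF hom scale[OF f] g \<xi>] algebra_homD(3)[OF hom f \<xi>]
        using closed f g \<xi> \<eta> by (simp add: inner_add_left inner_scale_left scale_closed)
      also have "\<dots> = c * hinner H \<xi> (\<pi> (star G f) \<eta>) + hinner H \<xi> (\<pi> (star G g) \<eta>)"
        using adj_f adj_g \<xi> \<eta> by (simp add: is_adjoint_def)
      also have "\<dots> = hinner H \<xi> (\<pi> (star G (fscale c f + g)) \<eta>)"
        unfolding star_add star_fscale algebra_homD(2)[OF hom scale[OF star(1)] star(2) \<eta>]
          algebra_homD(3)[OF hom star(1) \<eta>]
        using closed star \<xi> \<eta> by (simp add: inner_add_right inner_scale_right scale_closed)
      finally show "hinner H (\<pi> (fscale c f + g) \<xi>) \<eta>
          = hinner H \<xi> (\<pi> (star G (fscale c f + g)) \<eta>)" .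
    qed
    ultimately show ?case by blast
  qed
  then show ?thesis
    using hom A0_subset_span_bisections[OF _ \<F>(2)] \<F>(1)
    unfolding star_representation_def by blast
qed

end

section \<open>Coincidence of the two seminorms\<close>

theorem theorem3p24:
  fixes G :: "'g groupoid_data" and \<F> :: "'g set set"
  assumes "etale_groupoid G"
    and "\<And>U. U \<in> \<F> \<Longrightarrow> bisection G U \<and> compactin (gtop G) U"
    and "\<Union>\<F> = arrows G"
  shows "\<forall>f\<in>A0 G. A_seminorm TYPE('h) G f = Cstar_norm TYPE('h) G f"
proof -
  interpret etale_groupoid G by (rule assms(1))
  have "{(H :: 'h hilbert, \<pi>). hilbert_space H \<and> representation G H \<pi>}
      = {(H, \<pi>). hilbert_space H \<and> star_representation G H \<pi>}"
    using star_representation_imp_representation representation_imp_star_representation[OF _ _ assms(2,3)]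
    by blast
  then show ?thesis
    by (simp add: A_seminorm_def Cstar_norm_def)
qed

end
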